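(* Let $\delta\in(0,1/10)$, $K>0$, $M\ge1$, and let $N$ be an odd prime. Suppose $\alpha,a\in\mathbb R^d$ with $N\alpha\in\mathbb Z^d$, $|a|\le M$, $\beta\in\mathbb R$, and $\|\beta+a\cdot\{\alpha h\}\|_{\mathbb R/\mathbb Z}<K/N$ for at least $\delta N$ values $h\in[N]$. Then one of the following holds: (1) $N\ll(\delta/(d^dM))^{-O(1)}$ or $K/N>1/10$; (2) there exist an integer $r$, linearly independent $w_1,\dots,w_r\in\mathbb Z^d$ with $|w_1|\cdots|w_r|\le(\delta/(d^dM))^{-O(1)}$, and linearly independent $\eta_1,\dots,\eta_{d-r}\in\mathbb Z^d$ of size at most $(\delta/(d^dM))^{-O(1)}$ such that $\langle w_i,\eta_j\rangle=0$ for all $i,j$ and \[\|\eta_j\cdot\alpha\|_{\mathbb R/\mathbb Z}=0,\qquad |w_i\cdot a|\le\frac{(\delta/M)^{-O(1)}d^{O(d)}K}{N}.\]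
   Context: For $r\in\mathbb R$, $\{r\}\in(-1/2,1/2]$ denotes $r$ minus a nearest integer; for $x\in\mathbb R^d$, $\{x\}$ is taken coordinatewise. $|v|=\|v\|_\infty$. $[N]=\{1,\dots,N\}$. Implied constants in $O(1)$ are absolute. *)

theory Defs
  imports Complex_Main "HOL-Computational_Algebra.Primes"
begin

text \<open>Centered fractional part: r minus a nearest integer, with values in (-1/2, 1/2].\<close>
definition cfrac :: "real \<Rightarrow> real" where
  "cfrac r = r - of_int (ceiling (r - 1/2))"

definition rz_norm :: "real \<Rightarrow> real" where
  "rz_norm r = \<bar>cfrac r\<bar>"

definition supnorm_int :: "nat \<Rightarrow> (nat \<Rightarrow> int) \<Rightarrow> real" where
  "supnorm_int d v = Max (insert 0 ((\<lambda>k. real_of_int \<bar>v k\<bar>) ` {..<d}))"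

definition idot :: "nat \<Rightarrow> (nat \<Rightarrow> int) \<Rightarrow> (nat \<Rightarrow> real) \<Rightarrow> real" where
  "idot d v x = (\<Sum>k<d. real_of_int (v k) * x k)"

definition lin_indep_int :: "nat \<Rightarrow> nat \<Rightarrow> (nat \<Rightarrow> nat \<Rightarrow> int) \<Rightarrow> bool" where
  "lin_indep_int d r w \<longleftrightarrow>
     (\<forall>c :: nat \<Rightarrow> real. (\<forall>k<d. (\<Sum>i<r. c i * real_of_int (w i k)) = 0) \<longrightarrow> (\<forall>i<r. c i = 0))"

end

theory Submission
  imports Defs "HOL-Library.Function_Algebras" "HOL-Library.FuncSet"
begin

text \<open>
  Pigeonholing the integer nearest to \<open>\<beta> + a \<cdot> {\<alpha> h}\<close> and subtracting one member of the largest
  class gives a set \<open>X\<close> of at least \<open>\<delta> N / (d M + 2)\<close> points of the lattice \<open>\<Lambda> = \<int> \<alpha> + \<int>\<^sup>d\<close> in the unit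
  cube on which \<open>|a \<cdot> x| \<le> 2 K / N\<close>. Let \<open>V\<close> be the real span of \<open>X\<close>. Every point of \<open>V\<close> is close to a
  point of \<open>\<Lambda> \<inter> V\<close>, so translates of \<open>X\<close> can be packed into any large region of \<open>V\<close>, whereas \<open>\<Lambda>\<close> has only
  \<open>N\<close> classes modulo \<open>\<int>\<^sup>d\<close>. Packing transversally to the slab \<open>|a \<cdot> x| \<le> 2 K / N\<close> bounds the functional
  \<open>a\<close> on \<open>V\<close>. Packing into a box adapted to the successive minima of \<open>V \<inter> \<int>\<^sup>d\<close>, which contains few
  integer points, bounds the product of these minima and yields the \<open>w i\<close>. The \<open>\<eta> j\<close> come from Siegel's
  lemma for the system \<open>w i \<cdot> \<eta> = 0\<close>; they annihilate \<open>X\<close>, hence a multiple \<open>n \<alpha>\<close> modulo \<open>\<int>\<^sup>d\<close> with \<open>n\<close>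
  prime to \<open>N\<close>, and therefore \<open>\<eta> j \<cdot> \<alpha>\<close> is an integer.
\<close>

section \<open>Real vectors as functions\<close>

definition fscale :: "real \<Rightarrow> (nat \<Rightarrow> real) \<Rightarrow> nat \<Rightarrow> real" where
  "fscale c f = (\<lambda>k. c * f k)"

interpretation fv: vector_space fscale
  by unfold_locales (auto simp: fscale_def fun_eq_iff algebra_simps)

lemma sum_fun_apply: "(\<Sum>i\<in>A. f i) k = (\<Sum>i\<in>A. f i k)"
  for f :: "'i \<Rightarrow> nat \<Rightarrow> real"
  by (induction A rule: infinite_finite_induct) auto

definition ip :: "nat \<Rightarrow> (nat \<Rightarrow> real) \<Rightarrow> (nat \<Rightarrow> real) \<Rightarrow> real" where
  "ip d u v = (\<Sum>k<d. u k * v k)"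

lemma ip_commute: "ip d u v = ip d v u"
  by (simp add: ip_def mult.commute)

lemma ip_add_right [simp]: "ip d u (v + v') = ip d u v + ip d u v'"
  by (simp add: ip_def algebra_simps sum.distrib)

lemma ip_diff_right [simp]: "ip d u (v - v') = ip d u v - ip d u v'"
  by (simp add: ip_def algebra_simps sum_subtractf)

lemma ip_zero_right [simp]: "ip d u 0 = 0"
  by (simp add: ip_def)

lemma ip_scale_right [simp]: "ip d u (fscale c v) = c * ip d u v"
  by (simp add: ip_def fscale_def sum_distrib_left algebra_simps)

lemma ip_sum_right: "ip d u (\<Sum>i\<in>A. f i) = (\<Sum>i\<in>A. ip d u (f i))"
  unfolding ip_def sum_fun_apply sum_distrib_left by (rule sum.swap)

lemma ip_scale_left [simp]: "ip d (fscale c v) u = c * ip d v u"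
  by (simp add: ip_commute[of d _ u])

lemma ip_sum_left: "ip d (\<Sum>i\<in>A. f i) u = (\<Sum>i\<in>A. ip d (f i) u)"
  by (simp add: ip_commute[of d _ u] ip_sum_right)

lemma ip_self_nonneg: "ip d v v \<ge> 0"
  by (simp add: ip_def sum_nonneg)

lemma sq_le_ip_self: "k < d \<Longrightarrow> (v k)\<^sup>2 \<le> ip d v v"
  unfolding ip_def power2_eq_square by (rule member_le_sum) auto

text \<open>Squared norms of integer vectors are natural numbers, so least ones exist and the
  measure \<open>nat \<lfloor>ip d v v\<rfloor>\<close> orders integer vectors exactly by
  length.\<close>

lemma ip_self_int:
  assumes "\<And>k. k < d \<Longrightarrow> v k \<in> \<int>"
  shows "ip d v v = real (nat \<lfloor>ip d v v\<rfloor>)"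
proof -
  have "ip d v v \<in> \<int>" unfolding ip_def using assms by (intro Ints_sum Ints_mult) auto
  then show ?thesis using ip_self_nonneg[of d v] by (elim Ints_cases) auto
qed

text \<open>Model of R^d: with all coordinates from \<open>d\<close> on fixed at 0, equality of
  functions is equality of vectors and \<open>ip d\<close> is positive definite.\<close>

definition supp_below :: "nat \<Rightarrow> (nat \<Rightarrow> real) set" where
  "supp_below d = {v. \<forall>k\<ge>d. v k = 0}"

lemma subspace_supp_below: "fv.subspace (supp_below d)"
  by (auto simp: fv.subspace_def supp_below_def fscale_def)

lemma supp_below_eqI:
  "u \<in> supp_below d \<Longrightarrow> v \<in> supp_below d \<Longrightarrow> (\<And>k. k < d \<Longrightarrow> u k = v k) \<Longrightarrow> u = v"
  by (rule ext) (metis (mono_tags) mem_Collect_eq not_le supp_below_def)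

lemma ip_self_eq_0:
  assumes "v \<in> supp_below d" "ip d v v = 0"
  shows "v = 0"
proof (rule supp_below_eqI[OF assms(1)])
  show "0 \<in> supp_below d" by (simp add: supp_below_def)
next
  fix k assume "k < d"
  then show "v k = 0 k" using sq_le_ip_self[of k d v] assms(2) by simp
qed

lemma span_supp_below:
  "S \<subseteq> supp_below d \<Longrightarrow> fv.span S \<subseteq> supp_below d"
  by (rule fv.span_minimal[OF _ subspace_supp_below])

definition unit_fun :: "nat \<Rightarrow> nat \<Rightarrow> real" where
  "unit_fun j = (\<lambda>k. if k = j then 1 else 0)"

lemma supp_below_subset_span_units: "supp_below d \<subseteq> fv.span (unit_fun ` {..<d})"
proof
  fix v assume v: "v \<in> supp_below d"
  have "v = (\<Sum>j<d. fscale (v j) (unit_fun j))"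
  proof
    fix k
    have "(\<Sum>j<d. fscale (v j) (unit_fun j)) k = (\<Sum>j<d. if j = k then v j else 0)"
      unfolding sum_fun_apply by (rule sum.cong) (auto simp: fscale_def unit_fun_def)
    also have "\<dots> = v k" using v by (simp add: supp_below_def)
    finally show "v k = (\<Sum>j<d. fscale (v j) (unit_fun j)) k" by simp
  qed
  also have "\<dots> \<in> fv.span (unit_fun ` {..<d})"
    by (intro fv.span_sum fv.span_scale fv.span_base) auto
  finally show "v \<in> fv.span (unit_fun ` {..<d})" .
qed

lemma card_independent_le:
  assumes "B \<subseteq> supp_below d" "fv.independent B"
  shows "finite B" "card B \<le> d"
proof -
  have "finite B \<and> card B \<le> card (unit_fun ` {..<d})"
    by (rule fv.independent_span_bound) (use assms supp_below_subset_span_units in auto)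
  moreover have "card (unit_fun ` {..<d}) \<le> d"
    using card_image_le[of "{..<d}" unit_fun] by simp
  ultimately show "finite B" "card B \<le> d" by auto
qed

section \<open>Orthonormal systems: expansion, Parseval and length\<close>

definition orthonormal :: "nat \<Rightarrow> nat \<Rightarrow> (nat \<Rightarrow> nat \<Rightarrow> real) \<Rightarrow> bool" where
  "orthonormal d r e \<longleftrightarrow> (\<forall>i<r. e i \<in> supp_below d) \<and>
     (\<forall>i<r. \<forall>j<r. ip d (e i) (e j) = (if i = j then 1 else 0))"

lemma orthonormal_ip_sum:
  assumes "orthonormal d r e" "k \<le> r" "i < r"
  shows "ip d (e i) (\<Sum>j<k. fscale (c j) (e j)) = (if i < k then c i else 0)"
proof -
  have "ip d (e i) (\<Sum>j<k. fscale (c j) (e j)) = (\<Sum>j<k. if j = i then c j else 0)"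
    unfolding ip_sum_right using assms
    by (intro sum.cong) (auto simp: orthonormal_def)
  then show ?thesis by simp
qed

lemma orthonormal_expand:
  assumes "orthonormal d r e" "k \<le> r" "v \<in> fv.span (e ` {..<k})"
  shows "v = (\<Sum>i<k. fscale (ip d (e i) v) (e i))"
  using assms(3)
proof (induction rule: fv.span_induct_alt)
  case base
  show ?case unfolding ip_zero_right fv.scale_zero_left sum.neutral_const ..
next
  case (step c x y)
  then obtain j where j: "j < k" "x = e j" by auto
  have "(\<Sum>i<k. fscale (ip d (e i) (fscale c x + y)) (e i))
     = (\<Sum>i<k. fscale (c * (if i = j then 1 else 0)) (e i) + fscale (ip d (e i) y) (e i))"
    using j assms(1,2) by (intro sum.cong) (auto simp: orthonormal_def fv.scale_left_distrib)
  also have "\<dots> = (\<Sum>i<k. if i = j then fscale c (e i) else 0) + y"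
    unfolding sum.distrib step(2)[symmetric]
    by (intro arg_cong2[where f="(+)"] sum.cong refl) auto
  also have "\<dots> = fscale c x + y" using j by simp
  finally show ?case by (rule sym)
qed

lemma orthonormal_Parseval:
  assumes "orthonormal d r e" "k \<le> r" "v \<in> fv.span (e ` {..<k})"
  shows "ip d v v = (\<Sum>i<k. (ip d (e i) v)\<^sup>2)"
proof -
  have "ip d v v = ip d (\<Sum>i<k. fscale (ip d (e i) v) (e i)) v"
    using orthonormal_expand[OF assms] by simp
  also have "\<dots> = (\<Sum>i<k. (ip d (e i) v)\<^sup>2)"
    unfolding ip_sum_left by (simp add: power2_eq_square)
  finally show ?thesis .
qed

text \<open>If \<open>e r\<close> lay in the span of its predecessors, Parseval would write its
  squared norm 1 as a sum of vanishing squares.\<close>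

lemma orthonormal_independent:
  assumes "orthonormal d r e"
  shows "inj_on e {..<r}" "fv.independent (e ` {..<r})"
proof -
  show "inj_on e {..<r}"
    using assms unfolding inj_on_def orthonormal_def by (metis lessThan_iff zero_neq_one)
  then show "fv.independent (e ` {..<r})"
    using assms
  proof (induction r)
    case 0
    then show ?case by (simp add: fv.independent_empty)
  next
    case (Suc r)
    have "orthonormal d r e" using Suc.prems by (auto simp: orthonormal_def)
    then have ind: "fv.independent (e ` {..<r})"
      using Suc by (auto simp: inj_on_def)
    have "e r \<notin> fv.span (e ` {..<r})"
    proof
      assume "e r \<in> fv.span (e ` {..<r})"
      then have "ip d (e r) (e r) = (\<Sum>i<r. (ip d (e i) (e r))\<^sup>2)"
        using orthonormal_Parseval[OF Suc.prems(2), of r] by simp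
      then show False using Suc.prems(2) by (auto simp: orthonormal_def)
    qed
    then show ?case
      using ind by (simp add: lessThan_Suc fv.independent_insert)
  qed
qed

lemma orthonormal_le_dim:
  assumes "orthonormal d r e"
  shows "r \<le> d"
proof -
  have "card (e ` {..<r}) \<le> d"
    by (rule card_independent_le(2)[OF _ orthonormal_independent(2)[OF assms]])
      (use assms in \<open>auto simp: orthonormal_def\<close>)
  then show ?thesis
    using orthonormal_independent(1)[OF assms] by (simp add: card_image)
qed

section \<open>Greedy minimal flags\<close>

text \<open>Successive minima chosen greedily: each \<open>s i\<close> minimises \<open>m\<close> on
  the part of \<open>S\<close> outside the span of the earlier choices, and \<open>e\<close> is the
  Gram--Schmidt frame of \<open>s\<close>. The two span memberships make initial segments of
  \<open>s\<close> and \<open>e\<close> span the same spaces.\<close>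

definition minimal_flag ::
  "nat \<Rightarrow> ((nat \<Rightarrow> real) \<Rightarrow> nat) \<Rightarrow> (nat \<Rightarrow> real) set \<Rightarrow> nat \<Rightarrow>
   (nat \<Rightarrow> nat \<Rightarrow> real) \<Rightarrow> (nat \<Rightarrow> nat \<Rightarrow> real) \<Rightarrow> bool" where
  "minimal_flag d m S r s e \<longleftrightarrow> orthonormal d r e \<and>
     (\<forall>i<r. s i \<in> S \<and> s i \<in> fv.span (e ` {..<Suc i}) \<and> s i \<notin> fv.span (e ` {..<i}) \<and>
            e i \<in> fv.span (s ` {..<Suc i}) \<and>
            (\<forall>v\<in>S. v \<notin> fv.span (e ` {..<i}) \<longrightarrow> m (s i) \<le> m v))"

text \<open>One Gram--Schmidt step: a minimiser \<open>x\<close> outside the current span is split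
  into its projection \<open>p\<close> and an orthogonal remainder \<open>u\<close>, which is
  normalised to \<open>b\<close>.\<close>

lemma minimal_flag_extend:
  assumes flag: "minimal_flag d m S r s e" and S: "S \<subseteq> supp_below d"
    and ne: "\<not> S \<subseteq> fv.span (e ` {..<r})"
  shows "\<exists>s' e'. minimal_flag d m S (Suc r) s' e'"
proof -
  have on: "orthonormal d r e" using flag by (simp add: minimal_flag_def)
  have "\<exists>x. x \<in> S - fv.span (e ` {..<r}) \<and> (\<forall>y. y \<in> S - fv.span (e ` {..<r}) \<longrightarrow> m x \<le> m y)"
    using ne ex_has_least_nat[of "\<lambda>x. x \<in> S - fv.span (e ` {..<r})" _ m] by blast
  then obtain x where x: "x \<in> S" "x \<notin> fv.span (e ` {..<r})"
    and least: "\<And>y. y \<in> S \<Longrightarrow> y \<notin> fv.span (e ` {..<r}) \<Longrightarrow> m x \<le> m y"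
    by blast
  define p where "p = (\<Sum>i<r. fscale (ip d (e i) x) (e i))"
  define u where "u = x - p"
  define c where "c = sqrt (ip d u u)"
  define b where "b = fscale (1 / c) u"
  have p_span: "p \<in> fv.span (e ` {..<r})"
    unfolding p_def by (intro fv.span_sum fv.span_scale fv.span_base) auto
  have e_supp: "e ` {..<r} \<subseteq> supp_below d" using on by (auto simp: orthonormal_def)
  have p_supp: "p \<in> supp_below d" using span_supp_below[OF e_supp] p_span by blast
  have u_supp: "u \<in> supp_below d" unfolding u_def
    using x(1) S p_supp by (intro fv.subspace_diff[OF subspace_supp_below]) auto
  have "u \<noteq> 0" using x(2) p_span by (auto simp: u_def)
  then have "ip d u u > 0"
    using ip_self_eq_0[OF u_supp] ip_self_nonneg[of d u] by fastforce
  then have c: "c > 0" "c * c = ip d u u" by (auto simp: c_def)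
  have eu: "ip d (e i) u = 0" if "i < r" for i
    using orthonormal_ip_sum[OF on order_refl that, of "\<lambda>i. ip d (e i) x"] that
    by (simp add: u_def p_def)
  have eb: "ip d (e i) b = 0" if "i < r" for i
    using eu[OF that] by (simp add: b_def)
  have be: "ip d b (e i) = 0" if "i < r" for i
    using eb[OF that] by (simp add: ip_commute)
  have bb: "ip d b b = 1" using c \<open>ip d u u > 0\<close> by (simp add: b_def field_simps)
  have b_supp: "b \<in> supp_below d" unfolding b_def
    by (intro fv.subspace_scale[OF subspace_supp_below] u_supp)
  have xb: "x = fscale c b + p" using c by (simp add: b_def u_def)
  let ?e = "e(r := b)" and ?s = "s(r := x)"
  have e_im: "?e ` {..<i} = e ` {..<i}" if "i \<le> r" for i using that by (intro image_cong) auto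
  have s_im: "?s ` {..<i} = s ` {..<i}" if "i \<le> r" for i using that by (intro image_cong) auto
  have e_im': "?e ` {..<Suc r} = insert b (e ` {..<r})"
    by (auto simp: lessThan_Suc)
  have s_im': "?s ` {..<Suc r} = insert x (s ` {..<r})"
    by (auto simp: lessThan_Suc)
  have on': "orthonormal d (Suc r) ?e"
    using on eb be bb b_supp unfolding orthonormal_def by (auto simp: less_Suc_eq)
  have e_s: "e ` {..<r} \<subseteq> fv.span (s ` {..<r})"
  proof
    fix y assume "y \<in> e ` {..<r}"
    then obtain i where i: "i < r" "y = e i" by auto
    then have "y \<in> fv.span (s ` {..<Suc i})" using flag by (auto simp: minimal_flag_def)
    also have "\<dots> \<subseteq> fv.span (s ` {..<r})" using i by (intro fv.span_mono image_mono) auto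
    finally show "y \<in> fv.span (s ` {..<r})" .
  qed
  have "p \<in> fv.span (s ` {..<r})"
    using p_span e_s fv.span_minimal[OF _ fv.subspace_span] by blast
  then have "p \<in> fv.span (insert x (s ` {..<r}))"
    using fv.span_mono[of "s ` {..<r}" "insert x (s ` {..<r})"] by blast
  then have b_span: "b \<in> fv.span (insert x (s ` {..<r}))"
    unfolding b_def u_def by (intro fv.span_scale fv.span_diff) (auto intro: fv.span_base)
  have "p \<in> fv.span (insert b (e ` {..<r}))"
    using p_span fv.span_mono[of "e ` {..<r}" "insert b (e ` {..<r})"] by blast
  then have x_span: "x \<in> fv.span (insert b (e ` {..<r}))"
    by (subst xb) (intro fv.span_add fv.span_scale, auto intro: fv.span_base)
  have "minimal_flag d m S (Suc r) ?s ?e"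
    unfolding minimal_flag_def
  proof (intro conjI[OF on'] allI impI)
    fix i assume i: "i < Suc r"
    show "?s i \<in> S \<and> ?s i \<in> fv.span (?e ` {..<Suc i}) \<and> ?s i \<notin> fv.span (?e ` {..<i}) \<and>
            ?e i \<in> fv.span (?s ` {..<Suc i}) \<and>
            (\<forall>v\<in>S. v \<notin> fv.span (?e ` {..<i}) \<longrightarrow> m (?s i) \<le> m v)"
    proof (cases "i = r")
      case True
      then show ?thesis
        unfolding True e_im' s_im' e_im[OF order_refl]
        using x least x_span b_span by auto
    next
      case False
      then have "i < r" using i by simp
      then show ?thesis
        using flag e_im[of i] e_im[of "Suc i"] s_im[of "Suc i"] by (auto simp: minimal_flag_def)
    qed
  qed
  then show ?thesis by blast
qed

text \<open>The empty flag exists and lengths are bounded by the dimension; a flag of greatest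
  length cannot be extended, so its span contains \<open>S\<close>.\<close>

lemma minimal_flag_exists:
  assumes "S \<subseteq> supp_below d"
  obtains r s e where "r \<le> d" "minimal_flag d m S r s e" "S \<subseteq> fv.span (e ` {..<r})"
proof -
  let ?P = "\<lambda>r. \<exists>s e. minimal_flag d m S r s e"
  have P0: "?P 0" by (simp add: minimal_flag_def orthonormal_def)
  have bound: "r \<le> d" if "?P r" for r
    using that orthonormal_le_dim by (auto simp: minimal_flag_def)
  obtain r where r: "?P r" "\<And>r'. ?P r' \<Longrightarrow> r' \<le> r"
    using Nat.ex_has_greatest_nat[of ?P 0 d] P0 bound by blast
  then obtain s e where se: "minimal_flag d m S r s e" by blast
  have "S \<subseteq> fv.span (e ` {..<r})"
  proof (rule ccontr)
    assume "\<not> ?thesis"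
    then have "?P (Suc r)" using minimal_flag_extend[OF se assms] by blast
    then show False using r(2) by fastforce
  qed
  then show ?thesis using that se bound r(1) by blast
qed

section \<open>Counting points of the lattice generated by \<open>\<alpha>\<close> and the integer vectors\<close>

text \<open>The group generated by \<alpha> and Z^d inside the model of R^d. Once N \<alpha> is
  integral it has at most N classes modulo Z^d, the source of every count below.\<close>

definition bohr_lattice :: "nat \<Rightarrow> (nat \<Rightarrow> real) \<Rightarrow> (nat \<Rightarrow> real) set" where
  "bohr_lattice d \<alpha> = {v \<in> supp_below d. \<exists>m::int. \<forall>k<d. v k - of_int m * \<alpha> k \<in> \<int>}"

lemma bohr_lattice_supp: "v \<in> bohr_lattice d \<alpha> \<Longrightarrow> v \<in> supp_below d"
  by (simp add: bohr_lattice_def)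

lemma bohr_lattice_0: "0 \<in> bohr_lattice d \<alpha>"
  unfolding bohr_lattice_def supp_below_def by (auto intro!: exI[of _ 0])

lemma bohr_lattice_add:
  assumes "u \<in> bohr_lattice d \<alpha>" "v \<in> bohr_lattice d \<alpha>"
  shows "u + v \<in> bohr_lattice d \<alpha>"
proof -
  obtain m n :: int where m: "\<And>k. k < d \<Longrightarrow> u k - of_int m * \<alpha> k \<in> \<int>"
    and n: "\<And>k. k < d \<Longrightarrow> v k - of_int n * \<alpha> k \<in> \<int>"
    using assms by (auto simp: bohr_lattice_def)
  have "(u + v) k - of_int (m + n) * \<alpha> k \<in> \<int>" if "k < d" for k
    using Ints_add[OF m[OF that] n[OF that]] by (simp add: algebra_simps)
  then show ?thesis
    using assms fv.subspace_add[OF subspace_supp_below]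
    unfolding bohr_lattice_def by blast
qed

lemma bohr_lattice_scale:
  assumes "v \<in> bohr_lattice d \<alpha>"
  shows "fscale (of_int c) v \<in> bohr_lattice d \<alpha>"
proof -
  obtain n :: int where n: "\<And>k. k < d \<Longrightarrow> v k - of_int n * \<alpha> k \<in> \<int>"
    using assms by (auto simp: bohr_lattice_def)
  have "fscale (of_int c) v k - of_int (c * n) * \<alpha> k \<in> \<int>" if "k < d" for k
    using Ints_mult[OF Ints_of_int[of c] n[OF that]] by (simp add: fscale_def algebra_simps)
  then show ?thesis
    using assms fv.subspace_scale[OF subspace_supp_below]
    unfolding bohr_lattice_def by blast
qed

lemma bohr_lattice_sum:
  "(\<And>i. i \<in> A \<Longrightarrow> f i \<in> bohr_lattice d \<alpha>) \<Longrightarrow> (\<Sum>i\<in>A. f i) \<in> bohr_lattice d \<alpha>"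
  by (induction A rule: infinite_finite_induct)
     (use bohr_lattice_0 bohr_lattice_add in \<open>auto simp del: plus_fun_apply zero_fun_apply\<close>)

text \<open>A point of the span of \<open>X\<close> is rounded to a lattice point by rounding its coordinates in
  a basis contained in \<open>X\<close>; the error is then controlled in all directions simultaneously.\<close>

lemma bohr_lattice_rounding:
  assumes X: "X \<subseteq> bohr_lattice d \<alpha>" and z: "z \<in> fv.span X"
  obtains y where "y \<in> bohr_lattice d \<alpha>" "y \<in> fv.span X"
    "\<And>g t. 0 \<le> t \<Longrightarrow> (\<And>x. x \<in> X \<Longrightarrow> \<bar>ip d g x\<bar> \<le> t) \<Longrightarrow> \<bar>ip d g (y - z)\<bar> \<le> real d * t"
proof -
  obtain B where B: "B \<subseteq> X" "fv.independent B" "X \<subseteq> fv.span B"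
    using fv.maximal_independent_subset by blast
  have "B \<subseteq> supp_below d" using B(1) X bohr_lattice_supp by blast
  then have fin: "finite B" and card: "card B \<le> d" using card_independent_le B(2) by auto
  have "z \<in> fv.span B" using z B(3) fv.span_minimal[OF _ fv.subspace_span] by blast
  then obtain c where c: "z = (\<Sum>b\<in>B. fscale (c b) b)"
    using fv.span_finite[OF fin] by auto
  define y where "y = (\<Sum>b\<in>B. fscale (of_int \<lfloor>c b\<rfloor>) b)"
  have "y \<in> bohr_lattice d \<alpha>"
    unfolding y_def using B(1) X by (intro bohr_lattice_sum bohr_lattice_scale) auto
  moreover have "y \<in> fv.span X"
    unfolding y_def using B(1) by (intro fv.span_sum fv.span_scale fv.span_base) auto
  moreover have "\<bar>ip d g (y - z)\<bar> \<le> real d * t"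
    if t: "0 \<le> t" and g: "\<And>x. x \<in> X \<Longrightarrow> \<bar>ip d g x\<bar> \<le> t" for g t
  proof -
    have "ip d g (y - z) = (\<Sum>b\<in>B. (of_int \<lfloor>c b\<rfloor> - c b) * ip d g b)"
      by (simp add: y_def c ip_sum_right sum_subtractf algebra_simps)
    also have "\<bar>\<dots>\<bar> \<le> (\<Sum>b\<in>B. \<bar>(of_int \<lfloor>c b\<rfloor> - c b) * ip d g b\<bar>)" by (rule sum_abs)
    also have "\<dots> \<le> (\<Sum>b\<in>B. 1 * t)"
      unfolding abs_mult using g B(1) by (intro sum_mono mult_mono) (auto, linarith)
    also have "\<dots> \<le> real d * t" using card t by (simp add: mult_right_mono)
    finally show ?thesis .
  qed
  ultimately show ?thesis using that by blast
qed

text \<open>Each \<open>p y\<close> is congruent to a multiple m \<alpha> with 0 \<le> m < N, and by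
  \<open>inj\<close> the pair of m and label determines y. In the packing arguments
  \<open>label\<close> records the cell containing \<open>p y\<close>.\<close>

lemma card_le_classes:
  fixes p :: "'y \<Rightarrow> nat \<Rightarrow> real" and label :: "'y \<Rightarrow> 'l"
  assumes N: "N > 0" "\<And>k. k < d \<Longrightarrow> real N * \<alpha> k \<in> \<int>"
    and p: "\<And>y. y \<in> Y \<Longrightarrow> p y \<in> bohr_lattice d \<alpha>"
    and label: "label ` Y \<subseteq> T" "finite T"
    and inj: "\<And>y y'. y \<in> Y \<Longrightarrow> y' \<in> Y \<Longrightarrow> label y = label y' \<Longrightarrow>
       (\<And>k. k < d \<Longrightarrow> p y k - p y' k \<in> \<int>) \<Longrightarrow> y = y'"
  shows "card Y \<le> N * card T"
proof -
  have "\<exists>m\<in>{0..<int N}. \<forall>k<d. p y k - of_int m * \<alpha> k \<in> \<int>" if y: "y \<in> Y" for y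
  proof -
    obtain n :: int where n: "\<And>k. k < d \<Longrightarrow> p y k - of_int n * \<alpha> k \<in> \<int>"
      using p[OF y] by (auto simp: bohr_lattice_def)
    \<comment> \<open>Since N \<alpha> is integral, the multiplier may be reduced modulo N.\<close>
    have "p y k - of_int (n mod int N) * \<alpha> k \<in> \<int>" if "k < d" for k
    proof -
      have "real_of_int n = of_int (int N * (n div int N) + n mod int N)" by simp
      then have "real_of_int n = real N * of_int (n div int N) + of_int (n mod int N)"
        unfolding of_int_add of_int_mult by simp
      then have "p y k - of_int (n mod int N) * \<alpha> k
          = (p y k - of_int n * \<alpha> k) + of_int (n div int N) * (real N * \<alpha> k)"
        by (simp add: algebra_simps)
      then show ?thesis using n[OF that] N(2)[OF that] by (metis Ints_add Ints_mult Ints_of_int)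
    qed
    then show ?thesis using N(1) by (intro bexI[of _ "n mod int N"]) auto
  qed
  then obtain m where m: "\<And>y. y \<in> Y \<Longrightarrow> m y \<in> {0..<int N}"
    "\<And>y k. y \<in> Y \<Longrightarrow> k < d \<Longrightarrow> p y k - of_int (m y) * \<alpha> k \<in> \<int>"
    by metis
  have "inj_on (\<lambda>y. (m y, label y)) Y"
  proof (rule inj_onI)
    fix y y' assume yy: "y \<in> Y" "y' \<in> Y" "(m y, label y) = (m y', label y')"
    have "p y k - p y' k \<in> \<int>" if "k < d" for k
      using Ints_diff[OF m(2)[OF yy(1) that] m(2)[OF yy(2) that]] yy(3) by simp
    then show "y = y'" using inj yy by blast
  qed
  then have "card Y \<le> card ({0..<int N} \<times> T)"
    using m(1) label by (intro card_inj_on_le) auto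
  then show ?thesis by (simp add: card_cartesian_product)
qed

section \<open>Packing translates of \<open>X\<close> into regions of its span\<close>

locale dense_lattice_points =
  fixes d N :: nat and \<alpha> :: "nat \<Rightarrow> real" and X :: "(nat \<Rightarrow> real) set"
  assumes d_pos: "d > 0" and N_pos: "N > 0"
    and N\<alpha>: "\<And>k. k < d \<Longrightarrow> real N * \<alpha> k \<in> \<int>"
    and X_lattice: "X \<subseteq> bohr_lattice d \<alpha>"
    and X_bound: "\<And>x k. x \<in> X \<Longrightarrow> k < d \<Longrightarrow> \<bar>x k\<bar> \<le> 1"
begin

text \<open>Translates of \<open>X\<close> are stacked along \<open>v\<close>. Each lies in a thin
  slab around its own value of the functional \<open>a\<close>, so they are disjoint, while all stay
  in a box of side O(d). That box holds boundedly many points per class modulo Z^d, so few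
  translates fit and \<open>ip d a v\<close> is small.\<close>

lemma functional_bound:
  assumes a: "\<And>x. x \<in> X \<Longrightarrow> \<bar>ip d a x\<bar> \<le> \<kappa>" and \<kappa>: "\<kappa> > 0"
    and v: "v \<in> fv.span X" "\<And>k. k < d \<Longrightarrow> \<bar>v k\<bar> \<le> 1"
  shows "\<bar>ip d a v\<bar> * real (card X) \<le> 5 * real d * \<kappa> * real N * (2 * real d + 5) ^ d"
proof (cases "ip d a v = 0")
  case True
  then show ?thesis using \<kappa> by simp
next
  case False
  define A where "A = ip d a v"
  \<comment> \<open>The spacing exceeds the full slab width 2 (d + 1) \<kappa>: \<kappa> from
    \<open>X\<close> and d \<kappa> from rounding, on either side.\<close>
  define \<sigma> where "\<sigma> = 5 * real d * \<kappa>"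
  have \<sigma>: "\<sigma> > 0" using d_pos \<kappa> by (simp add: \<sigma>_def)
  define J where "J = nat \<lfloor>\<bar>A\<bar> / \<sigma>\<rfloor>"
  \<comment> \<open>The multiple of \<open>v\<close> on which the functional equals \<sigma> j; for
    j \<le> J it is still in the unit cube.\<close>
  define z where "z j = fscale (\<sigma> * real j / A) v" for j :: nat
  have z_span: "z j \<in> fv.span X" for j unfolding z_def by (intro fv.span_scale v)
  have "\<exists>y. y \<in> bohr_lattice d \<alpha> \<and> (\<forall>g t. 0 \<le> t \<longrightarrow> (\<forall>x\<in>X. \<bar>ip d g x\<bar> \<le> t) \<longrightarrow>
      \<bar>ip d g (y - z j)\<bar> \<le> real d * t)" for j
    using bohr_lattice_rounding[OF X_lattice z_span[of j]] by metis
  then obtain y where y: "\<And>j. y j \<in> bohr_lattice d \<alpha>"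
    and y_close: "\<And>j g t. 0 \<le> t \<Longrightarrow> (\<And>x. x \<in> X \<Longrightarrow> \<bar>ip d g x\<bar> \<le> t) \<Longrightarrow>
      \<bar>ip d g (y j - z j)\<bar> \<le> real d * t"
    by metis
  have az: "ip d a (z j) = \<sigma> * real j" for j using False by (simp add: z_def A_def)
  have ay: "\<bar>ip d a (x + y j) - \<sigma> * real j\<bar> \<le> (real d + 1) * \<kappa>" if "x \<in> X" for x j
  proof -
    have "\<bar>ip d a (y j - z j)\<bar> \<le> real d * \<kappa>" using a \<kappa> by (intro y_close) auto
    then show ?thesis using a[OF that] by (simp add: az algebra_simps)
  qed
  have zk: "\<bar>z j k\<bar> \<le> 1" if "j \<le> J" "k < d" for j k
  proof -
    have "real j \<le> \<bar>A\<bar> / \<sigma>"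
      using that(1) \<sigma> unfolding J_def by (simp add: le_nat_floor le_nat_iff le_floor_iff)
    then have "\<bar>\<sigma> * real j / A\<bar> \<le> 1"
      using \<sigma> False by (simp add: A_def field_simps abs_mult)
    then show ?thesis
      using v(2)[OF that(2)] mult_le_one[of "\<bar>\<sigma> * real j / A\<bar>" "\<bar>v k\<bar>"]
      by (simp only: z_def fscale_def abs_mult abs_ge_zero)
  qed
  have coord: "ip d (unit_fun k) u = u k" if "k < d" for k u
    using that by (simp add: ip_def unit_fun_def if_distrib[of "\<lambda>c. c * _"] cong: if_cong)
  \<comment> \<open>Coordinates are functionals bounded by 1 on \<open>X\<close>, so the same
    rounding estimate applies to them: 1 from \<open>z j\<close>, d from rounding, 1 from
    \<open>x\<close>.\<close>
  have xyk: "\<bar>(x + y j) k\<bar> \<le> real d + 2" if "x \<in> X" "j \<le> J" "k < d" for x j k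
  proof -
    have "\<bar>ip d (unit_fun k) (y j - z j)\<bar> \<le> real d * 1"
      using X_bound that(3) by (intro y_close) (auto simp: coord)
    then have "\<bar>y j k - z j k\<bar> \<le> real d" using coord[OF that(3)] by simp
    then show ?thesis using zk[OF that(2,3)] X_bound[OF that(1,3)] by simp
  qed
  \<comment> \<open>The label is the unit cube containing the point; a floor lies between -(d + 2)
    and d + 2, which leaves 2 d + 5 values. Two points of one cube with integer difference
    coincide.\<close>
  let ?T = "PiE {..<d} (\<lambda>_. {- int (d + 2)..int (d + 2)})"
  have "card (X \<times> {..J}) \<le> N * card ?T"
  proof (rule card_le_classes[where p = "\<lambda>(x, j). x + y j" and
        label = "\<lambda>(x, j). \<lambda>k\<in>{..<d}. \<lfloor>(x + y j) k\<rfloor>" and \<alpha> = \<alpha> and d = d])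
    show "N > 0" "\<And>k. k < d \<Longrightarrow> real N * \<alpha> k \<in> \<int>" using N_pos N\<alpha> by auto
    show "(case q of (x, j) \<Rightarrow> x + y j) \<in> bohr_lattice d \<alpha>" if "q \<in> X \<times> {..J}" for q
      using that y X_lattice by (cases q) (auto intro!: bohr_lattice_add simp del: plus_fun_apply)
    show "(\<lambda>(x, j). \<lambda>k\<in>{..<d}. \<lfloor>(x + y j) k\<rfloor>) ` (X \<times> {..J}) \<subseteq> ?T"
    proof (intro image_subsetI)
      fix q assume "q \<in> X \<times> {..J}"
      then obtain x j where q: "q = (x, j)" "x \<in> X" "j \<le> J" by auto
      have "\<lfloor>(x + y j) k\<rfloor> \<in> {- int (d + 2)..int (d + 2)}" if "k < d" for k
        using xyk[OF q(2,3) that] by (auto simp: le_floor_iff floor_le_iff abs_le_iff)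
      then show "(case q of (x, j) \<Rightarrow> \<lambda>k\<in>{..<d}. \<lfloor>(x + y j) k\<rfloor>) \<in> ?T"
        unfolding q by auto
    qed
    show "finite ?T" by (intro finite_PiE) auto
    fix q q' assume qq: "q \<in> X \<times> {..J}" "q' \<in> X \<times> {..J}"
      and lab: "(case q of (x, j) \<Rightarrow> \<lambda>k\<in>{..<d}. \<lfloor>(x + y j) k\<rfloor>)
              = (case q' of (x, j) \<Rightarrow> \<lambda>k\<in>{..<d}. \<lfloor>(x + y j) k\<rfloor>)"
      and int: "\<And>k. k < d \<Longrightarrow> (case q of (x, j) \<Rightarrow> x + y j) k - (case q' of (x, j) \<Rightarrow> x + y j) k \<in> \<int>"
    obtain x j x' j' where q: "q = (x, j)" "q' = (x', j')" by (cases q, cases q') auto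
    have eq: "x + y j = x' + y j'"
    proof (rule supp_below_eqI[where d = d])
      show "x + y j \<in> supp_below d" "x' + y j' \<in> supp_below d"
        using qq y X_lattice unfolding q
        by (auto intro!: bohr_lattice_supp[of _ d \<alpha>] bohr_lattice_add simp del: plus_fun_apply)
      fix k assume k: "k < d"
      have "(\<lambda>k\<in>{..<d}. \<lfloor>(x + y j) k\<rfloor>) k = (\<lambda>k\<in>{..<d}. \<lfloor>(x' + y j') k\<rfloor>) k"
        using lab unfolding q prod.case by (rule fun_cong)
      then have fl: "\<lfloor>(x + y j) k\<rfloor> = \<lfloor>(x' + y j') k\<rfloor>" using k by simp
      have "(x + y j) k - (x' + y j') k \<in> \<int>" using int[OF k] by (simp add: q)
      then obtain n :: int where n: "(x + y j) k - (x' + y j') k = of_int n" by (elim Ints_cases)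
      have "n = 0" using fl n by linarith
      then show "(x + y j) k = (x' + y j') k" using n by simp
    qed
    have "\<bar>\<sigma> * real j - \<sigma> * real j'\<bar> \<le> 2 * (real d + 1) * \<kappa>"
    proof -
      have "\<bar>ip d a (x + y j) - \<sigma> * real j\<bar> \<le> (real d + 1) * \<kappa>"
        "\<bar>ip d a (x + y j) - \<sigma> * real j'\<bar> \<le> (real d + 1) * \<kappa>"
        using ay[of x j] ay[of x' j'] qq unfolding q eq by blast+
      then show ?thesis unfolding mult.assoc[of 2] by linarith
    qed
    also have "\<dots> < \<sigma>"
    proof -
      have "2 * (real d + 1) < 5 * real d" using d_pos by simp
      then show ?thesis unfolding \<sigma>_def using \<kappa> by (rule mult_strict_right_mono)
    qed
    finally have "\<sigma> * \<bar>real j - real j'\<bar> < \<sigma> * 1"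
      using \<sigma> by (simp add: abs_mult flip: right_diff_distrib)
    then have "j = j'" using \<sigma> by (simp add: abs_if split: if_splits)
    then show "q = q'" using eq q by simp
  qed
  moreover have "card ?T = (2 * d + 5) ^ d"
  proof -
    have "card {- int (d + 2)..int (d + 2)} = 2 * d + 5" by (simp add: nat_eq_iff)
    then show ?thesis by (simp only: card_PiE finite_lessThan prod_constant card_lessThan)
  qed
  ultimately have "card X * (J + 1) \<le> N * (2 * d + 5) ^ d"
    by (simp add: card_cartesian_product)
  then have "real (card X * (J + 1)) \<le> real (N * (2 * d + 5) ^ d)"
    by (simp only: of_nat_le_iff)
  then have "real (card X) * (real J + 1) \<le> real N * (2 * real d + 5) ^ d"
    by (simp add: algebra_simps)
  \<comment> \<open>The index 0 counts too, so there are J + 1 translates and rounding \<bar>A\<bar>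
    / \<sigma> down loses nothing.\<close>
  moreover have "\<bar>A\<bar> / \<sigma> \<le> real J + 1" unfolding J_def by linarith
  ultimately have "real (card X) * (\<bar>A\<bar> / \<sigma>) \<le> real N * (2 * real d + 5) ^ d"
    by (meson mult_left_mono of_nat_0_le_iff order_trans)
  then have "real (card X) * \<bar>A\<bar> \<le> \<sigma> * (real N * (2 * real d + 5) ^ d)"
    using \<sigma> by (simp add: field_simps)
  then show ?thesis by (simp add: A_def \<sigma>_def algebra_simps)
qed

text \<open>Translates of \<open>X\<close> are placed near a grid of spacing 5 d^2 in the frame
  \<open>e\<close>, filling a box with sides about \<mu> i / d. By \<open>gap\<close>, points of one
  cell with these side lengths that differ by an integer vector coincide, so each cell holds at most
  N points, and O(d^3) cells per direction suffice.\<close>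

lemma prod_minima_bound:
  fixes e :: "nat \<Rightarrow> nat \<Rightarrow> real" and \<mu> :: "nat \<Rightarrow> real"
  assumes on: "orthonormal d r e" and e_span: "\<And>i. i < r \<Longrightarrow> e i \<in> fv.span X"
    and \<mu>: "\<And>i. i < r \<Longrightarrow> \<mu> i \<ge> 1"
    and gap: "\<And>v. v \<in> fv.span X \<Longrightarrow> (\<And>k. k < d \<Longrightarrow> v k \<in> \<int>) \<Longrightarrow>
       (\<And>i. i < r \<Longrightarrow> \<bar>ip d (e i) v\<bar> < \<mu> i / real d) \<Longrightarrow> v = 0"
  shows "real (card X) * (\<Prod>i<r. \<mu> i) \<le> real N * (5 * real d ^ 3 * (4 * real d ^ 3 + 2)) ^ r"
proof -
  define D where "D = real d"
  have D: "D \<ge> 1" using d_pos by (simp add: D_def)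
  define l where "l i = \<mu> i / D" for i
  \<comment> \<open>\<open>n i\<close> is the number of multiples of the spacing in the half-open
    interval from 0 to \<open>l i\<close>.\<close>
  define n where "n i = nat \<lceil>l i / (5 * D\<^sup>2)\<rceil>" for i
  have l: "l i \<ge> 1 / D" if "i < r" for i
    using \<mu>[OF that] D by (simp add: l_def divide_right_mono)
  have l_pos: "l i > 0" if "i < r" for i
    using l[OF that] D by (meson divide_pos_pos less_le_trans zero_less_one order.strict_trans2)
  have n_lower: "l i / (5 * D\<^sup>2) \<le> real (n i)" for i
    unfolding n_def by (rule real_nat_ceiling_ge)
  have n_upper: "5 * D\<^sup>2 * real j < l i" if "i < r" "j < n i" for i j
  proof -
    have "real j < l i / (5 * D\<^sup>2)" using that(2) unfolding n_def by linarith
    then show ?thesis using D by (simp add: field_simps)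
  qed
  define J where "J = PiE {..<r} (\<lambda>i. {..<n i})"
  define z where "z j = (\<Sum>i<r. fscale (5 * D\<^sup>2 * real (j i)) (e i))" for j :: "nat \<Rightarrow> nat"
  have z_span: "z j \<in> fv.span X" for j
    unfolding z_def using e_span by (intro fv.span_sum fv.span_scale) auto
  have ez: "ip d (e i) (z j) = 5 * D\<^sup>2 * real (j i)" if "i < r" for i j
    unfolding z_def using orthonormal_ip_sum[OF on order_refl that] that by simp
  have "\<exists>y. y \<in> bohr_lattice d \<alpha> \<and> y \<in> fv.span X \<and>
      (\<forall>g t. 0 \<le> t \<longrightarrow> (\<forall>x\<in>X. \<bar>ip d g x\<bar> \<le> t) \<longrightarrow> \<bar>ip d g (y - z j)\<bar> \<le> real d * t)" for j
    using bohr_lattice_rounding[OF X_lattice z_span[of j]] by metis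
  then obtain y where y: "\<And>j. y j \<in> bohr_lattice d \<alpha>" "\<And>j. y j \<in> fv.span X"
    and y_close: "\<And>j g t. 0 \<le> t \<Longrightarrow> (\<And>x. x \<in> X \<Longrightarrow> \<bar>ip d g x\<bar> \<le> t) \<Longrightarrow>
      \<bar>ip d g (y j - z j)\<bar> \<le> real d * t"
    by metis
  have ex: "\<bar>ip d (e i) x\<bar> \<le> D" if "i < r" "x \<in> X" for i x
  proof -
    have "\<bar>e i k\<bar> \<le> 1" if "k < d" for k
    proof -
      have "(e i k)\<^sup>2 \<le> 1"
        using sq_le_ip_self[OF that, of "e i"] on \<open>i < r\<close> by (simp add: orthonormal_def)
      then show ?thesis by (simp add: abs_square_le_1)
    qed
    then have "(\<Sum>k<d. \<bar>e i k * x k\<bar>) \<le> (\<Sum>k<d. 1 :: real)"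
      using X_bound[OF that(2)] by (intro sum_mono) (auto simp: abs_mult mult_le_one)
    then have "(\<Sum>k<d. \<bar>e i k * x k\<bar>) \<le> real d" by simp
    then show ?thesis unfolding ip_def D_def using sum_abs[of "\<lambda>k. e i k * x k" "{..<d}"] by linarith
  qed
  \<comment> \<open>In direction \<open>e i\<close> the set \<open>X\<close> has half-width at most
    D and rounding costs at most D * D. The total 2 D^2 is less than half the spacing, so a point
    determines its grid index.\<close>
  have exy: "\<bar>ip d (e i) (x + y j) - 5 * D\<^sup>2 * real (j i)\<bar> \<le> 2 * D\<^sup>2" if "i < r" "x \<in> X" for i x j
  proof -
    have "\<bar>ip d (e i) (y j - z j)\<bar> \<le> real d * D"
      using ex[OF that(1)] D by (intro y_close) auto
    moreover have "D \<le> D\<^sup>2" using D by (simp add: power2_eq_square)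
    ultimately show ?thesis using ex[OF that] ez[OF that(1), of j]
      by (simp add: D_def[symmetric] power2_eq_square)
  qed
  \<comment> \<open>The label is the cell index. Adding 2 D^2 makes it nonnegative; the quotient
    stays below 1 + 4 D^2 / \<open>l i\<close>, where \<open>l i\<close> \<ge> 1 / D, so indices 0
    to 4 d^3 + 1 suffice.\<close>
  define lab where "lab = (\<lambda>(x, j). \<lambda>i\<in>{..<r}. \<lfloor>(ip d (e i) (x + y j) + 2 * D\<^sup>2) / l i\<rfloor>)"
  let ?T = "PiE {..<r} (\<lambda>_. {0..int (4 * d ^ 3 + 1)})"
  have "card (X \<times> J) \<le> N * card ?T"
  proof (rule card_le_classes[where p = "\<lambda>(x, j). x + y j" and label = lab and \<alpha> = \<alpha> and d = d])
    show "N > 0" "\<And>k. k < d \<Longrightarrow> real N * \<alpha> k \<in> \<int>" using N_pos N\<alpha> by auto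
    show "(case q of (x, j) \<Rightarrow> x + y j) \<in> bohr_lattice d \<alpha>" if "q \<in> X \<times> J" for q
      using that y X_lattice by (cases q) (auto intro!: bohr_lattice_add simp del: plus_fun_apply)
    show "lab ` (X \<times> J) \<subseteq> ?T"
    proof (intro image_subsetI)
      fix q assume "q \<in> X \<times> J"
      then obtain x j where q: "q = (x, j)" "x \<in> X" "j \<in> J" by auto
      have "\<lfloor>(ip d (e i) (x + y j) + 2 * D\<^sup>2) / l i\<rfloor> \<in> {0..int (4 * d ^ 3 + 1)}" if i: "i < r" for i
      proof -
        let ?w = "ip d (e i) (x + y j) + 2 * D\<^sup>2"
        have "j i < n i" using q(3) i by (auto simp: J_def)
        then have "5 * D\<^sup>2 * real (j i) < l i" using n_upper i by blast
        moreover have "0 \<le> 5 * D\<^sup>2 * real (j i)" by simp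
        ultimately have w: "0 \<le> ?w" "?w < l i + 4 * D\<^sup>2" using exy[OF i q(2), of j] by linarith+
        have "1 \<le> l i * D" using l[OF i] D by (simp add: field_simps)
        then have "4 * D\<^sup>2 * 1 \<le> 4 * D\<^sup>2 * (l i * D)" by (intro mult_left_mono) auto
        then have "?w < l i * (4 * D ^ 3 + 2)"
          using w(2) l_pos[OF i] by (simp add: algebra_simps power2_eq_square power3_eq_cube)
        then have "?w / l i < 4 * D ^ 3 + 2"
          using l_pos[OF i] by (simp add: field_simps)
        then have "?w / l i < of_int (int (4 * d ^ 3 + 1) + 1)" by (simp add: D_def)
        then have "\<lfloor>?w / l i\<rfloor> \<le> int (4 * d ^ 3 + 1)"
          by (simp only: floor_le_iff of_int_add of_int_1)
        moreover have "0 \<le> \<lfloor>?w / l i\<rfloor>" using w(1) l_pos[OF i] by simp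
        ultimately show ?thesis by simp
      qed
      then show "lab q \<in> ?T" unfolding q lab_def by auto
    qed
    show "finite ?T" by (intro finite_PiE) auto
    fix q q' assume qq: "q \<in> X \<times> J" "q' \<in> X \<times> J" and lab: "lab q = lab q'"
      and int: "\<And>k. k < d \<Longrightarrow> (case q of (x, j) \<Rightarrow> x + y j) k - (case q' of (x, j) \<Rightarrow> x + y j) k \<in> \<int>"
    obtain x j x' j' where q: "q = (x, j)" "q' = (x', j')" by (cases q, cases q') auto
    have mem: "x \<in> X" "x' \<in> X" "j \<in> J" "j' \<in> J" using qq q by auto
    have "(x + y j) - (x' + y j') = 0"
    proof (rule gap)
      show "(x + y j) - (x' + y j') \<in> fv.span X"
        using mem y(2) by (intro fv.span_diff fv.span_add) (auto intro: fv.span_base)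
      show "((x + y j) - (x' + y j')) k \<in> \<int>" if "k < d" for k
        using int[OF that] by (simp add: q)
      fix i assume i: "i < r"
      have "lab (x, j) i = lab (x', j') i" using lab q by simp
      then have "\<lfloor>(ip d (e i) (x + y j) + 2 * D\<^sup>2) / l i\<rfloor> = \<lfloor>(ip d (e i) (x' + y j') + 2 * D\<^sup>2) / l i\<rfloor>"
        using i by (simp add: lab_def)
      then have "\<bar>(ip d (e i) (x + y j) + 2 * D\<^sup>2) / l i - (ip d (e i) (x' + y j') + 2 * D\<^sup>2) / l i\<bar> < 1"
        by linarith
      then have "\<bar>(ip d (e i) (x + y j) - ip d (e i) (x' + y j')) / l i\<bar> < 1"
        by (simp flip: diff_divide_distrib)
      then show "\<bar>ip d (e i) ((x + y j) - (x' + y j'))\<bar> < \<mu> i / real d"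
        using l_pos[OF i] unfolding ip_diff_right[of _ _ "x + y j"] l_def[symmetric] D_def[symmetric]
        by (simp add: abs_divide)
    qed
    then have eq: "x + y j = x' + y j'" by simp
    have "j i = j' i" if i: "i < r" for i
    proof -
      have "\<bar>5 * D\<^sup>2 * real (j i) - 5 * D\<^sup>2 * real (j' i)\<bar> \<le> 4 * D\<^sup>2"
        using exy[OF i mem(1), of j] exy[OF i mem(2), of j'] unfolding eq by linarith
      also have "\<dots> < 5 * D\<^sup>2" using D by simp
      finally have "5 * D\<^sup>2 * \<bar>real (j i) - real (j' i)\<bar> < 5 * D\<^sup>2 * 1"
        by (simp add: abs_mult flip: right_diff_distrib)
      then have "\<bar>real (j i) - real (j' i)\<bar> < 1"
        by (rule mult_left_less_imp_less) simp
      then show ?thesis by linarith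
    qed
    then have "j = j'" using mem(3,4) unfolding J_def by (intro PiE_ext) auto
    then show "q = q'" using eq q by simp
  qed
  moreover have "card ?T = (4 * d ^ 3 + 2) ^ r"
  proof -
    have "card {0..int (4 * d ^ 3 + 1)} = 4 * d ^ 3 + 2" by (simp add: nat_eq_iff)
    then show ?thesis by (simp only: card_PiE finite_lessThan prod_constant card_lessThan)
  qed
  moreover have "card J = (\<Prod>i<r. n i)" unfolding J_def by (simp add: card_PiE)
  ultimately have "card X * (\<Prod>i<r. n i) \<le> N * (4 * d ^ 3 + 2) ^ r"
    by (simp only: card_cartesian_product)
  then have "real (card X * (\<Prod>i<r. n i)) \<le> real (N * (4 * d ^ 3 + 2) ^ r)"
    by (simp only: of_nat_le_iff)
  then have count: "real (card X) * (\<Prod>i<r. real (n i)) \<le> real N * (4 * D ^ 3 + 2) ^ r"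
    by (simp add: D_def add.commute)
  have "(\<Prod>i<r. \<mu> i) \<le> (\<Prod>i<r. 5 * D ^ 3 * real (n i))"
  proof (rule prod_mono)
    fix i assume "i \<in> {..<r}"
    moreover have "\<mu> i \<le> 5 * D ^ 3 * real (n i)"
      using n_lower[of i] D
      by (simp add: l_def field_simps power2_eq_square power3_eq_cube)
    ultimately show "0 \<le> \<mu> i \<and> \<mu> i \<le> 5 * D ^ 3 * real (n i)" using \<mu>[of i] by simp
  qed
  also have "\<dots> = (5 * D ^ 3) ^ r * (\<Prod>i<r. real (n i))" by (simp add: prod.distrib)
  finally have "real (card X) * (\<Prod>i<r. \<mu> i)
      \<le> (5 * D ^ 3) ^ r * (real (card X) * (\<Prod>i<r. real (n i)))"
    using mult_left_mono[of _ _ "real (card X)"] by (simp add: mult.left_commute)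
  also have "\<dots> \<le> (5 * D ^ 3) ^ r * (real N * (4 * D ^ 3 + 2) ^ r)"
    using D by (intro mult_left_mono count) auto
  finally show ?thesis by (simp add: D_def power_mult_distrib mult_ac)
qed

end

section \<open>Integer vectors orthogonal to given ones\<close>

text \<open>Siegel's lemma for r equations in r + 1 unknowns: the vectors with entries in 0..H
  outnumber the possible values of the r forms, so two of them share all values and their difference
  is the solution.\<close>

lemma siegel_pigeonhole:
  fixes w :: "nat \<Rightarrow> nat \<Rightarrow> int" and W :: "nat \<Rightarrow> nat"
  assumes I: "finite I" "card I = r + 1"
    and W: "\<And>i. i < r \<Longrightarrow> W i \<ge> 1" "\<And>i k. i < r \<Longrightarrow> k \<in> I \<Longrightarrow> \<bar>w i k\<bar> \<le> int (W i)"
  shows "\<exists>u :: nat \<Rightarrow> int. (\<exists>k\<in>I. u k \<noteq> 0) \<and> (\<forall>k. k \<notin> I \<longrightarrow> u k = 0) \<and>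
     (\<forall>k. \<bar>u k\<bar> \<le> int ((2 * r + 3) ^ r * (\<Prod>i<r. W i))) \<and>
     (\<forall>i<r. (\<Sum>k\<in>I. w i k * u k) = 0)"
proof -
  \<comment> \<open>Form i takes at most 2 (r + 1) \<open>W i\<close> H + 1 \<le> (2 r + 3)
    \<open>W i\<close> H values. With this H the product of these bounds is H^(r + 1), below the
    number (H + 1)^(r + 1) of vectors.\<close>
  define H where "H = (2 * r + 3) ^ r * (\<Prod>i<r. W i)"
  have H1: "H \<ge> 1" unfolding H_def using W(1) by (simp add: Suc_le_eq prod_pos)
  define B where "B = PiE I (\<lambda>_. {0..int H})"
  define T where "T = PiE {..<r} (\<lambda>i. {- int ((r + 1) * W i * H)..int ((r + 1) * W i * H)})"
  define f where "f u = (\<lambda>i\<in>{..<r}. \<Sum>k\<in>I. w i k * u k)" for u :: "nat \<Rightarrow> int"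
  have fB: "f ` B \<subseteq> T"
  proof (intro image_subsetI)
    fix u assume u: "u \<in> B"
    have "\<bar>\<Sum>k\<in>I. w i k * u k\<bar> \<le> int ((r + 1) * W i * H)" if i: "i < r" for i
    proof -
      have "\<bar>\<Sum>k\<in>I. w i k * u k\<bar> \<le> (\<Sum>k\<in>I. \<bar>w i k * u k\<bar>)" by (rule sum_abs)
      also have "\<dots> \<le> (\<Sum>k\<in>I. int (W i) * int H)"
        unfolding abs_mult using W(2)[OF i] u
        by (intro sum_mono mult_mono) (auto simp: B_def PiE_iff)
      finally show ?thesis using I(2) by (simp add: algebra_simps)
    qed
    then show "f u \<in> T" unfolding f_def T_def by (auto simp: abs_le_iff minus_le_iff)
  qed
  have finT: "finite T" unfolding T_def by (intro finite_PiE) auto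
  have "card T = (\<Prod>i<r. 2 * ((r + 1) * W i * H) + 1)"
    unfolding T_def by (subst card_PiE) (auto intro!: prod.cong simp flip: of_nat_mult of_nat_add)
  also have "\<dots> \<le> (\<Prod>i<r. (2 * r + 3) * W i * H)"
  proof (rule prod_mono)
    fix i assume "i \<in> {..<r}"
    then have "1 \<le> W i * H" using W(1)[of i] H1 by (simp add: Suc_le_eq)
    then show "0 \<le> 2 * ((r + 1) * W i * H) + 1 \<and> 2 * ((r + 1) * W i * H) + 1 \<le> (2 * r + 3) * W i * H"
      by (simp add: algebra_simps)
  qed
  also have "\<dots> = H * H ^ r" by (simp add: prod.distrib H_def)
  also have "\<dots> < (H + 1) * (H + 1) ^ r"
    by (intro mult_less_le_imp_less power_mono) (use H1 in auto)
  also have "\<dots> = card B" unfolding B_def using I by (simp add: card_PiE nat_add_distrib)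
  finally have "card T < card B" .
  then have "card (f ` B) < card B" using card_mono[OF finT fB] by linarith
  then have "\<not> inj_on f B" using pigeonhole by blast
  then obtain u v where uv: "u \<in> B" "v \<in> B" "u \<noteq> v" "f u = f v" by (auto simp: inj_on_def)
  define x where "x k = (if k \<in> I then u k - v k else 0)" for k
  have "\<exists>k\<in>I. u k \<noteq> v k" using uv(1-3) unfolding B_def by (metis PiE_ext)
  then have "\<exists>k\<in>I. x k \<noteq> 0" by (auto simp: x_def)
  moreover have "\<forall>k. k \<notin> I \<longrightarrow> x k = 0" by (simp add: x_def)
  moreover have "\<bar>x k\<bar> \<le> int H" for k
  proof (cases "k \<in> I")
    case True
    then have "u k \<in> {0..int H}" "v k \<in> {0..int H}" using uv(1,2) unfolding B_def by auto
    then show ?thesis by (auto simp: x_def)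
  qed (simp add: x_def)
  moreover have "(\<Sum>k\<in>I. w i k * x k) = 0" if "i < r" for i
  proof -
    have "f u i = f v i" using uv(4) by simp
    then show ?thesis using that by (simp add: f_def x_def algebra_simps sum_subtractf)
  qed
  ultimately show ?thesis unfolding H_def by blast
qed

text \<open>Each new vector is supported on the coordinates that are still available and uses up one of
  them, at which it does not vanish; this triangular shape makes the vectors independent.\<close>

lemma orthogonal_integer_vectors:
  fixes w :: "nat \<Rightarrow> nat \<Rightarrow> int" and W :: "nat \<Rightarrow> nat"
  assumes W: "\<forall>i<r. W i \<ge> 1" "\<forall>i<r. \<forall>k<d. \<bar>w i k\<bar> \<le> int (W i)"
  shows "n + r \<le> d \<Longrightarrow> \<exists>(\<eta> :: nat \<Rightarrow> nat \<Rightarrow> int) I. I \<subseteq> {..<d} \<and> card I = d - n \<and>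
     (\<forall>c :: nat \<Rightarrow> real. (\<forall>k. k < d \<and> k \<notin> I \<longrightarrow> (\<Sum>j<n. c j * real_of_int (\<eta> j k)) = 0) \<longrightarrow> (\<forall>j<n. c j = 0)) \<and>
     (\<forall>j<n. \<forall>k. \<bar>\<eta> j k\<bar> \<le> int ((2 * r + 3) ^ r * (\<Prod>i<r. W i))) \<and>
     (\<forall>i<r. \<forall>j<n. (\<Sum>k<d. w i k * \<eta> j k) = 0)"
proof (induction n)
  case 0
  then show ?case by (intro exI[of _ "\<lambda>_ _. 0"] exI[of _ "{..<d}"]) auto
next
  case (Suc n)
  have "n + r \<le> d" using Suc.prems by simp
  from Suc.IH[OF this] obtain \<eta> :: "nat \<Rightarrow> nat \<Rightarrow> int" and I where I: "I \<subseteq> {..<d}" "card I = d - n"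
    and indep: "\<forall>c :: nat \<Rightarrow> real. (\<forall>k. k < d \<and> k \<notin> I \<longrightarrow> (\<Sum>j<n. c j * real_of_int (\<eta> j k)) = 0)
        \<longrightarrow> (\<forall>j<n. c j = 0)"
    and small: "\<forall>j<n. \<forall>k. \<bar>\<eta> j k\<bar> \<le> int ((2 * r + 3) ^ r * (\<Prod>i<r. W i))"
    and orth: "\<forall>i<r. \<forall>j<n. (\<Sum>k<d. w i k * \<eta> j k) = 0"
    by (elim exE conjE) (rule that)
  have finI: "finite I" using I(1) finite_subset by blast
  \<comment> \<open>At least r + 1 coordinates are still available, which is one more unknown than
    there are equations.\<close>
  obtain I' where I': "I' \<subseteq> I" "card I' = r + 1" "finite I'"
    by (rule obtain_subset_with_card_n[of "r + 1" I]) (use I(2) Suc.prems in auto)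
  obtain u :: "nat \<Rightarrow> int" where u: "\<exists>k\<in>I'. u k \<noteq> 0" "\<forall>k. k \<notin> I' \<longrightarrow> u k = 0"
     "\<forall>k. \<bar>u k\<bar> \<le> int ((2 * r + 3) ^ r * (\<Prod>i<r. W i))"
     "\<forall>i<r. (\<Sum>k\<in>I'. w i k * u k) = 0"
  proof -
    have "\<bar>w i k\<bar> \<le> int (W i)" if "i < r" "k \<in> I'" for i k
      using W(2) that I'(1) I(1) by blast
    with siegel_pigeonhole[OF I'(3,2), of W w] W(1) show ?thesis using that by blast
  qed
  obtain q where q: "q \<in> I'" "u q \<noteq> 0" using u(1) by blast
  have qI: "q \<in> I" "q < d" using q I' I by auto
  let ?\<eta> = "\<eta>(n := u)"
  have eta_sum: "(\<Sum>j<Suc n. c j * real_of_int (?\<eta> j k))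
      = (\<Sum>j<n. c j * real_of_int (\<eta> j k)) + c n * real_of_int (u k)" for c :: "nat \<Rightarrow> real" and k
    by simp
  show ?case
  proof (intro exI[of _ ?\<eta>] exI[of _ "I - {q}"] conjI allI impI)
    show "I - {q} \<subseteq> {..<d}" using I by auto
    show "card (I - {q}) = d - Suc n" using qI I(2) finI by simp
    show "\<bar>?\<eta> j k\<bar> \<le> int ((2 * r + 3) ^ r * (\<Prod>i<r. W i))" if "j < Suc n" for j k
      using that small u(3) by (auto simp: less_Suc_eq)
    show "(\<Sum>k<d. w i k * ?\<eta> j k) = 0" if "i < r" "j < Suc n" for i j
    proof (cases "j = n")
      case True
      have "(\<Sum>k<d. w i k * u k) = (\<Sum>k\<in>I'. w i k * u k)"
        using I' I u(2) by (intro sum.mono_neutral_right) auto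
      then show ?thesis using True u(4) that by simp
    next
      case False
      then show ?thesis using orth that by simp
    qed
    fix c :: "nat \<Rightarrow> real" and j
    assume c: "\<forall>k. k < d \<and> k \<notin> I - {q} \<longrightarrow> (\<Sum>j<Suc n. c j * real_of_int (?\<eta> j k)) = 0" and j: "j < Suc n"
    \<comment> \<open>Outside \<open>I\<close> the new vector vanishes, so the old relations are
      recovered and kill the old coefficients; coordinate \<open>q\<close> then kills the last
      one.\<close>
    have "(\<Sum>j<n. c j * real_of_int (\<eta> j k)) = 0" if "k < d" "k \<notin> I" for k
    proof -
      have "u k = 0" using u(2) I'(1) that(2) by blast
      then show ?thesis using c that eta_sum[of c k] by auto
    qed
    then have c0: "\<forall>j<n. c j = 0" using indep by blast
    moreover have "c n = 0"
    proof -
      have "(\<Sum>j<Suc n. c j * real_of_int (?\<eta> j q)) = 0" using c qI by blast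
      then show ?thesis unfolding eta_sum using c0 q(2) by simp
    qed
    ultimately show "c j = 0" using j by (auto simp: less_Suc_eq)
  qed
qed

section \<open>Successive minima of the integer points of the span\<close>

context dense_lattice_points
begin

text \<open>Minkowski's argument: successive minima \<open>s i\<close> of the integer points of the span, in the
  Gram--Schmidt frame \<open>e\<close>, leave no nonzero integer point in the box of side lengths comparable
  to the minima.\<close>

lemma flag_gap:
  fixes s e :: "nat \<Rightarrow> nat \<Rightarrow> real"
  defines "S \<equiv> {v \<in> fv.span X. \<forall>k<d. v k \<in> \<int>}"
  assumes flag: "minimal_flag d (\<lambda>v. nat \<lfloor>ip d v v\<rfloor>) S r s e"
    and span: "fv.span X \<subseteq> fv.span (e ` {..<r})"
    and v: "v \<in> fv.span X" "\<And>k. k < d \<Longrightarrow> v k \<in> \<int>"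
    and small: "\<And>i. i < r \<Longrightarrow> \<bar>ip d (e i) v\<bar> < sqrt (ip d (s i) (s i)) / real d"
  shows "v = 0"
proof (rule ccontr)
  assume "v \<noteq> 0"
  have on: "orthonormal d r e" using flag by (simp add: minimal_flag_def)
  have rd: "r \<le> d" by (rule orthonormal_le_dim[OF on])
  have vS: "v \<in> S" using v by (simp add: S_def)
  have sS: "s i \<in> S" if "i < r" for i using flag that by (simp add: minimal_flag_def)
  have int_norm: "ip d u u = real (nat \<lfloor>ip d u u\<rfloor>)" if "u \<in> S" for u
    using that by (intro ip_self_int) (simp add: S_def)
  have min: "ip d (s i) (s i) \<le> ip d u u" if "i < r" "u \<in> S" "u \<notin> fv.span (e ` {..<i})" for i u
  proof -
    have "nat \<lfloor>ip d (s i) (s i)\<rfloor> \<le> nat \<lfloor>ip d u u\<rfloor>"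
      using flag that by (simp add: minimal_flag_def)
    then show ?thesis
      by (subst int_norm[OF sS[OF that(1)]], subst int_norm[OF that(2)]) (simp only: of_nat_le_iff)
  qed
  have expand: "v = (\<Sum>i<r. fscale (ip d (e i) v) (e i))"
    using orthonormal_expand[OF on order_refl] span v(1) by blast
  have "\<exists>k<r. ip d (e k) v \<noteq> 0"
  proof (rule ccontr)
    assume "\<not> ?thesis"
    then have "(\<Sum>i<r. fscale (ip d (e i) v) (e i)) = 0" by (intro sum.neutral) auto
    then show False using expand \<open>v \<noteq> 0\<close> by metis
  qed
  \<comment> \<open>Let k be the last direction in which v has a component. It will turn out that v
    is shorter than \<open>s k\<close>; minimality then puts v in the span of the first k frame
    vectors, against the choice of k.\<close>
  then obtain k where k: "k < r" "ip d (e k) v \<noteq> 0"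
    and last: "\<And>i. i < r \<Longrightarrow> ip d (e i) v \<noteq> 0 \<Longrightarrow> i \<le> k"
    using Nat.ex_has_greatest_nat[of "\<lambda>k. k < r \<and> ip d (e k) v \<noteq> 0" _ r] by (metis less_imp_le)
  \<comment> \<open>The minima do not decrease, because \<open>s k\<close> was a candidate in every
    earlier choice.\<close>
  have mono: "ip d (s i) (s i) \<le> ip d (s k) (s k)" if "i \<le> k" for i
  proof (rule min)
    show "i < r" "s k \<in> S" using that k(1) sS by auto
    have "fv.span (e ` {..<i}) \<subseteq> fv.span (e ` {..<k})"
      using that by (intro fv.span_mono image_mono) auto
    then show "s k \<notin> fv.span (e ` {..<i})"
      using flag k(1) by (auto simp: minimal_flag_def)
  qed
  define q where "q = ip d (s k) (s k)"
  have q: "q \<ge> 0" by (simp add: q_def ip_self_nonneg)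
  have sq: "(ip d (e i) v)\<^sup>2 < q / (real d)\<^sup>2" if "i \<le> k" for i
  proof -
    have "\<bar>ip d (e i) v\<bar> < sqrt (ip d (s i) (s i)) / real d" using small that k(1) by simp
    also have "\<dots> \<le> sqrt q / real d"
      unfolding q_def using mono[OF that] by (intro divide_right_mono real_sqrt_le_mono) auto
    finally have "\<bar>ip d (e i) v\<bar>\<^sup>2 < (sqrt q / real d)\<^sup>2" by (intro power_strict_mono) auto
    then show ?thesis using q by (simp add: power_divide)
  qed
  have "ip d v v = (\<Sum>i<r. (ip d (e i) v)\<^sup>2)"
    using orthonormal_Parseval[OF on order_refl] span v(1) by blast
  also have "\<dots> = (\<Sum>i<Suc k. (ip d (e i) v)\<^sup>2)"
    using k(1) last by (intro sum.mono_neutral_right) (fastforce simp: less_Suc_eq_le)+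
  also have "\<dots> < (\<Sum>i<Suc k. q / (real d)\<^sup>2)"
    using sq by (intro sum_strict_mono) (auto simp: less_Suc_eq_le)
  also have "\<dots> = real (Suc k) * q / (real d)\<^sup>2" by simp
  \<comment> \<open>Dividing the side lengths by d pays for the at most d squared
    components.\<close>
  also have "\<dots> \<le> q"
  proof -
    have "real (Suc k) \<le> real d" using k(1) rd by simp
    also have "\<dots> \<le> (real d)\<^sup>2" using d_pos by (simp add: power2_eq_square)
    finally have "real (Suc k) * q \<le> (real d)\<^sup>2 * q" using q by (rule mult_right_mono)
    then show ?thesis using d_pos by (simp add: field_simps)
  qed
  finally have "v \<in> fv.span (e ` {..<k})"
    using min[OF k(1) vS] unfolding q_def by linarith
  then have "v = (\<Sum>i<k. fscale (ip d (e i) v) (e i))"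
    using orthonormal_expand[OF on] k(1) by simp
  then have "ip d (e k) v = 0"
    using orthonormal_ip_sum[OF on _ k(1), of k "\<lambda>i. ip d (e i) v"] k(1) by simp
  then show False using k(2) by simp
qed

text \<open>The \<open>w i\<close> are the successive minima \<open>s i\<close> of the integer
  points of the span. Their sup norms are at most their Euclidean lengths \<mu> i, whose product
  \<open>prod_minima_bound\<close> controls, with \<open>gap\<close> supplied by
  \<open>flag_gap\<close>.\<close>

lemma short_integer_basis:
  obtains r w where "r \<le> d" "lin_indep_int d r w"
    "\<And>i. i < r \<Longrightarrow> (\<lambda>k. real_of_int (w i k)) \<in> fv.span X"
    "\<And>i. i < r \<Longrightarrow> supnorm_int d (w i) \<ge> 1"
    "X \<subseteq> fv.span ((\<lambda>i k. real_of_int (w i k)) ` {..<r})"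
    "real (card X) * (\<Prod>i<r. supnorm_int d (w i)) \<le> real N * (30 * real d ^ 6) ^ d"
proof -
  let ?m = "\<lambda>v. nat \<lfloor>ip d v v\<rfloor>"
  define S where "S = {v \<in> fv.span X. \<forall>k<d. v k \<in> \<int>}"
  have X_supp: "X \<subseteq> supp_below d" using X_lattice bohr_lattice_supp by blast
  have V_supp: "fv.span X \<subseteq> supp_below d" by (rule span_supp_below[OF X_supp])
  then have "S \<subseteq> supp_below d" by (auto simp: S_def)
  then obtain r s e where r: "r \<le> d" and flag: "minimal_flag d ?m S r s e"
    and S_span: "S \<subseteq> fv.span (e ` {..<r})"
    by (rule minimal_flag_exists)
  have on: "orthonormal d r e" using flag by (simp add: minimal_flag_def)
  have sS: "s i \<in> S" "s i \<notin> fv.span (e ` {..<i})" if "i < r" for i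
    using flag that by (auto simp: minimal_flag_def)
  have s_low: "s i \<in> fv.span (e ` {..<j})" if "i < j" "j \<le> r" for i j
  proof -
    have "s i \<in> fv.span (e ` {..<Suc i})" using flag that by (auto simp: minimal_flag_def)
    also have "\<dots> \<subseteq> fv.span (e ` {..<j})" using that by (intro fv.span_mono image_mono) auto
    finally show ?thesis .
  qed
  have e_s: "e i \<in> fv.span (s ` {..<r})" if "i < r" for i
  proof -
    have "e i \<in> fv.span (s ` {..<Suc i})" using flag that by (auto simp: minimal_flag_def)
    also have "\<dots> \<subseteq> fv.span (s ` {..<r})" using that by (intro fv.span_mono image_mono) auto
    finally show ?thesis .
  qed
  have "s ` {..<r} \<subseteq> fv.span X" using sS by (auto simp: S_def)
  then have "fv.span (s ` {..<r}) \<subseteq> fv.span X"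
    by (intro fv.span_minimal fv.subspace_span)
  then have e_span: "e i \<in> fv.span X" if "i < r" for i using e_s that by blast
  have X_span: "X \<subseteq> fv.span (e ` {..<r})"
  proof
    fix x assume x: "x \<in> X"
    obtain n :: int where n: "\<And>k. k < d \<Longrightarrow> x k - of_int n * \<alpha> k \<in> \<int>"
      using x X_lattice by (auto simp: bohr_lattice_def)
    \<comment> \<open>The multiple N x is an integer point of the span, so the integer points alone
      span all of \<open>X\<close>.\<close>
    have "real N * x k \<in> \<int>" if "k < d" for k
    proof -
      have "real N * x k = of_int (int N) * (x k - of_int n * \<alpha> k) + of_int n * (real N * \<alpha> k)"
        by (simp add: algebra_simps)
      then show ?thesis using n[OF that] N\<alpha>[OF that] by (metis Ints_add Ints_mult Ints_of_int)
    qed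
    then have "fscale (real N) x \<in> S"
      unfolding S_def using fv.span_scale[OF fv.span_base[OF x]] by (simp add: fscale_def)
    then have "fscale (1 / real N) (fscale (real N) x) \<in> fv.span (e ` {..<r})"
      using S_span by (blast intro: fv.span_scale)
    then show "x \<in> fv.span (e ` {..<r})" using N_pos by simp
  qed
  then have V_span: "fv.span X \<subseteq> fv.span (e ` {..<r})"
    by (intro fv.span_minimal fv.subspace_span)
  define \<mu> where "\<mu> i = sqrt (ip d (s i) (s i))" for i
  have \<mu>: "\<mu> i \<ge> 1" if "i < r" for i
  proof -
    have "s i \<noteq> 0" using sS(2)[OF that] fv.span_zero by metis
    then have "ip d (s i) (s i) \<noteq> 0"
      using ip_self_eq_0[of "s i" d] sS(1)[OF that] V_supp by (auto simp: S_def)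
    moreover have "ip d (s i) (s i) = real (?m (s i))"
      using sS(1)[OF that] by (intro ip_self_int) (simp add: S_def)
    ultimately have "ip d (s i) (s i) \<ge> 1"
      by (metis One_nat_def Suc_leI neq0_conv of_nat_0 of_nat_1 of_nat_le_iff)
    then show ?thesis by (simp add: \<mu>_def)
  qed
  have count: "real (card X) * (\<Prod>i<r. \<mu> i) \<le> real N * (5 * real d ^ 3 * (4 * real d ^ 3 + 2)) ^ r"
  proof (rule prod_minima_bound[OF on e_span \<mu>])
    fix v assume "v \<in> fv.span X" "\<And>k. k < d \<Longrightarrow> v k \<in> \<int>"
      "\<And>i. i < r \<Longrightarrow> \<bar>ip d (e i) v\<bar> < \<mu> i / real d"
    then show "v = 0"
      using flag_gap[OF flag[unfolded S_def] V_span] by (auto simp: \<mu>_def)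
  qed
  \<comment> \<open>The entries of \<open>s i\<close> are integers already; the floor only changes
    their type.\<close>
  define w where "w i k = \<lfloor>s i k\<rfloor>" for i k
  have ws: "real_of_int (w i k) = s i k" if "i < r" for i k
  proof (cases "k < d")
    case True
    then have "s i k \<in> \<int>" using sS(1)[OF that] by (simp add: S_def)
    then show ?thesis by (simp add: w_def)
  next
    case False
    then have "s i k = 0" using sS(1)[OF that] V_supp by (auto simp: S_def supp_below_def)
    then show ?thesis by (simp add: w_def)
  qed
  have ws': "(\<lambda>k. real_of_int (w i k)) = s i" if "i < r" for i using ws[OF that] by auto
  have sup: "1 \<le> supnorm_int d (w i)" "supnorm_int d (w i) \<le> \<mu> i" if i: "i < r" for i
  proof -
    have abs_le: "real_of_int \<bar>w i k\<bar> \<le> \<mu> i" if "k < d" for k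
    proof -
      have "\<bar>s i k\<bar> \<le> \<mu> i"
        unfolding \<mu>_def using sq_le_ip_self[OF that, of "s i"] by (intro real_le_rsqrt) simp
      then show ?thesis using ws[OF i, of k] by simp
    qed
    then show "supnorm_int d (w i) \<le> \<mu> i"
      unfolding supnorm_int_def using \<mu>[OF i] by (subst Max_le_iff) auto
    have "s i \<noteq> 0" using sS(2)[OF i] fv.span_zero by metis
    then obtain k where k: "s i k \<noteq> 0" by (auto simp: fun_eq_iff)
    have "s i \<in> supp_below d" using sS(1)[OF i] V_supp by (auto simp: S_def)
    then have kd: "k < d" using k by (metis (mono_tags) mem_Collect_eq not_le supp_below_def)
    have "w i k \<noteq> 0" using k ws[OF i, of k] by auto
    then have "1 \<le> real_of_int \<bar>w i k\<bar>" by linarith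
    also have "\<dots> \<le> supnorm_int d (w i)"
      unfolding supnorm_int_def using kd by (intro Max_ge) auto
    finally show "1 \<le> supnorm_int d (w i)" .
  qed
  have indep: "lin_indep_int d r w"
    unfolding lin_indep_int_def
  proof (intro allI impI, rule ccontr)
    fix c :: "nat \<Rightarrow> real" and i
    assume c: "\<forall>k<d. (\<Sum>i<r. c i * real_of_int (w i k)) = 0" and i: "i < r" "c i \<noteq> 0"
    \<comment> \<open>Solving the relation for the last vector with nonzero coefficient puts
      \<open>s j\<close> in the span of its predecessors, which the flag forbids.\<close>
    obtain j where j: "j < r" "c j \<noteq> 0" and last: "\<And>i. i < r \<Longrightarrow> c i \<noteq> 0 \<Longrightarrow> i \<le> j"
      using Nat.ex_has_greatest_nat[of "\<lambda>k. k < r \<and> c k \<noteq> 0" i r] i by (metis less_imp_le)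
    have "(\<Sum>i<Suc j. c i * s i k) = 0" for k
    proof (cases "k < d")
      case True
      have "(\<Sum>i<Suc j. c i * s i k) = (\<Sum>i<r. c i * s i k)"
        using j(1) last by (intro sum.mono_neutral_left) (fastforce simp: less_Suc_eq_le)+
      also have "\<dots> = 0" using c True ws by simp
      finally show ?thesis .
    next
      case False
      have "s i k = 0" if "i < r" for i
        using sS(1)[OF that] V_supp False by (auto simp: S_def supp_below_def)
      then show ?thesis using j(1) by (intro sum.neutral) auto
    qed
    then have "c j * s j k = (\<Sum>i<j. - (c i * s i k))" for k
      by (simp add: sum_negf eq_neg_iff_add_eq_0 add.commute)
    then have "s j k = (\<Sum>i<j. - c i / c j * s i k)" for k
      using j(2) by (simp add: field_simps sum_divide_distrib[symmetric] sum_negf)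
    then have "s j = (\<Sum>i<j. fscale (- c i / c j) (s i))"
      unfolding fun_eq_iff sum_fun_apply fscale_def by blast
    also have "\<dots> \<in> fv.span (e ` {..<j})"
      using s_low j(1) by (intro fv.span_sum fv.span_scale) auto
    finally show False using sS(2)[OF j(1)] by blast
  qed
  have "(\<lambda>i k. real_of_int (w i k)) ` {..<r} = s ` {..<r}"
    using ws' by (intro image_cong) auto
  moreover have "fv.span (e ` {..<r}) \<subseteq> fv.span (s ` {..<r})"
    using e_s by (intro fv.span_minimal fv.subspace_span) auto
  ultimately have X_w: "X \<subseteq> fv.span ((\<lambda>i k. real_of_int (w i k)) ` {..<r})"
    using X_span by auto
  have d1: "real d \<ge> 1" using d_pos by simp
  have base: "5 * real d ^ 3 * (4 * real d ^ 3 + 2) \<le> 30 * real d ^ 6"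
  proof -
    have "2 \<le> 2 * real d ^ 3" using d1 by simp
    then have "5 * real d ^ 3 * (4 * real d ^ 3 + 2) \<le> 5 * real d ^ 3 * (6 * real d ^ 3)"
      by (intro mult_left_mono) auto
    then show ?thesis by (simp flip: power_add)
  qed
  have "real (card X) * (\<Prod>i<r. supnorm_int d (w i)) \<le> real (card X) * (\<Prod>i<r. \<mu> i)"
    using sup by (intro mult_left_mono prod_mono) (auto intro: order_trans[OF zero_le_one])
  also note count
  also have "real N * (5 * real d ^ 3 * (4 * real d ^ 3 + 2)) ^ r \<le> real N * (30 * real d ^ 6) ^ r"
    using base by (intro mult_left_mono power_mono) auto
  also have "\<dots> \<le> real N * (30 * real d ^ 6) ^ d"
  proof (intro mult_left_mono power_increasing r)
    show "1 \<le> 30 * real d ^ 6" using one_le_power[OF d1, of 6] by simp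
  qed auto
  finally have "real (card X) * (\<Prod>i<r. supnorm_int d (w i)) \<le> real N * (30 * real d ^ 6) ^ d" .
  moreover have "(\<lambda>k. real_of_int (w i k)) \<in> fv.span X" if "i < r" for i
    using ws'[OF that] sS(1)[OF that] by (simp add: S_def)
  ultimately show ?thesis using that[OF r indep] sup(1) X_w by blast
qed

end

section \<open>The orthogonal systems \<open>w\<close> and \<open>\<eta>\<close>\<close>

lemma idot_eq_ip: "idot d v x = ip d (\<lambda>k. real_of_int (v k)) x"
  by (simp add: idot_def ip_def)

lemma abs_le_supnorm_int: "k < d \<Longrightarrow> real_of_int \<bar>v k\<bar> \<le> supnorm_int d v"
  unfolding supnorm_int_def by (intro Max_ge) auto

lemma supnorm_int_le:
  "0 \<le> b \<Longrightarrow> (\<And>k. k < d \<Longrightarrow> real_of_int \<bar>v k\<bar> \<le> b) \<Longrightarrow> supnorm_int d v \<le> b"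
  unfolding supnorm_int_def by (subst Max_le_iff) auto

context dense_lattice_points
begin

text \<open>\<open>L\<close> bounds the inverse density of \<open>X\<close>. Siegel's lemma makes
  each \<open>\<eta> j\<close> orthogonal to all \<open>w i\<close>, hence to \<open>X\<close> in
  their span. Each \<open>w i\<close> divided by its norm is a point of the unit cube in the span of
  \<open>X\<close>, where \<open>functional_bound\<close> controls \<open>a\<close>.\<close>

lemma short_orthogonal_systems:
  fixes L \<kappa> :: real
  assumes a: "\<forall>x\<in>X. \<bar>ip d a x\<bar> \<le> \<kappa>" and \<kappa>: "\<kappa> > 0"
    and card: "card X > 0" and L: "real N \<le> L * real (card X)"
  defines "P \<equiv> L * (30 * real d ^ 6) ^ d"
  shows "\<exists>r\<le>d. \<exists>w \<eta>. lin_indep_int d r w \<and> (\<Prod>i<r. supnorm_int d (w i)) \<le> P \<and>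
    lin_indep_int d (d - r) \<eta> \<and> (\<forall>j<d - r. supnorm_int d (\<eta> j) \<le> (5 * real d) ^ d * P) \<and>
    (\<forall>i<r. \<forall>j<d - r. (\<Sum>k<d. w i k * \<eta> j k) = 0) \<and>
    (\<forall>j<d - r. \<forall>x\<in>X. idot d (\<eta> j) x = 0) \<and>
    (\<forall>i<r. \<bar>idot d (w i) a\<bar> \<le> P * (5 * real d * \<kappa> * L * (2 * real d + 5) ^ d))"
proof -
  obtain r w where r: "r \<le> d" and indep: "lin_indep_int d r w"
    and w_span: "\<And>i. i < r \<Longrightarrow> (\<lambda>k. real_of_int (w i k)) \<in> fv.span X"
    and sup1: "\<And>i. i < r \<Longrightarrow> supnorm_int d (w i) \<ge> 1"
    and X_span: "X \<subseteq> fv.span ((\<lambda>i k. real_of_int (w i k)) ` {..<r})"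
    and prod: "real (card X) * (\<Prod>i<r. supnorm_int d (w i)) \<le> real N * (30 * real d ^ 6) ^ d"
    using short_integer_basis by metis
  have card': "real (card X) > 0" using card by simp
  have d1: "real d \<ge> 1" using d_pos by simp
  let ?pr = "\<Prod>i<r. supnorm_int d (w i)"
  have "real (card X) * ?pr \<le> (L * real (card X)) * (30 * real d ^ 6) ^ d"
    using prod L by (elim order_trans) (intro mult_right_mono, auto)
  also have "\<dots> = real (card X) * P" by (simp add: P_def)
  finally have prP: "?pr \<le> P" using card' by (simp only: mult_le_cancel_left_pos)
  have supP: "supnorm_int d (w i) \<le> P" if "i < r" for i
  proof -
    have "supnorm_int d (w i) * 1 \<le> supnorm_int d (w i) * (\<Prod>i\<in>{..<r} - {i}. supnorm_int d (w i))"
      using sup1 sup1[OF that] by (intro mult_left_mono prod_ge_1) auto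
    also have "\<dots> = ?pr" using that by (subst prod.remove[of _ i]) auto
    finally show ?thesis using prP by simp
  qed
  \<comment> \<open>Siegel's lemma needs natural bounds; since the entries are integers, they are
    still bounded by the floor of the norm.\<close>
  define W where "W i = nat \<lfloor>supnorm_int d (w i)\<rfloor>" for i
  have W1: "W i \<ge> 1" if "i < r" for i using sup1[OF that] by (simp add: W_def le_nat_iff le_floor_iff)
  have W2: "\<bar>w i k\<bar> \<le> int (W i)" if "i < r" "k < d" for i k
  proof -
    have "\<bar>w i k\<bar> \<le> \<lfloor>supnorm_int d (w i)\<rfloor>"
      using abs_le_supnorm_int[OF that(2), of "w i"] by (simp add: le_floor_iff)
    then show ?thesis using sup1[OF that(1)] by (simp add: W_def)
  qed
  have W3: "real (W i) \<le> supnorm_int d (w i)" if "i < r" for i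
    using sup1[OF that] by (simp add: W_def)
  have "\<forall>i<r. W i \<ge> 1" "\<forall>i<r. \<forall>k<d. \<bar>w i k\<bar> \<le> int (W i)" "(d - r) + r \<le> d"
    using W1 W2 r by auto
  from orthogonal_integer_vectors[OF this]
  obtain \<eta> :: "nat \<Rightarrow> nat \<Rightarrow> int" and I where
    eta_indep: "\<forall>c :: nat \<Rightarrow> real. (\<forall>k. k < d \<and> k \<notin> I \<longrightarrow>
        (\<Sum>j<d - r. c j * real_of_int (\<eta> j k)) = 0) \<longrightarrow> (\<forall>j<d - r. c j = 0)"
    and eta_small: "\<forall>j<d - r. \<forall>k. \<bar>\<eta> j k\<bar> \<le> int ((2 * r + 3) ^ r * (\<Prod>i<r. W i))"
    and eta_orth: "\<forall>i<r. \<forall>j<d - r. (\<Sum>k<d. w i k * \<eta> j k) = 0"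
    by (elim exE conjE) (rule that)
  have "lin_indep_int d (d - r) \<eta>"
    unfolding lin_indep_int_def using eta_indep by blast
  moreover have "supnorm_int d (\<eta> j) \<le> (5 * real d) ^ d * P" if j: "j < d - r" for j
  proof -
    have bd: "real ((2 * r + 3) ^ r * (\<Prod>i<r. W i)) \<le> (5 * real d) ^ d * P"
    proof -
      have "(2 * real r + 3) ^ r \<le> (5 * real d) ^ r"
        using r d1 by (intro power_mono) auto
      also have "\<dots> \<le> (5 * real d) ^ d" using r d1 by (intro power_increasing) auto
      finally have "(2 * real r + 3) ^ r * (\<Prod>i<r. real (W i)) \<le> (5 * real d) ^ d * ?pr"
        using W3 by (intro mult_mono prod_mono) (auto intro: prod_nonneg)
      also have "\<dots> \<le> (5 * real d) ^ d * P" using prP by (intro mult_left_mono) auto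
      finally show ?thesis by simp
    qed
    have eb: "real_of_int \<bar>\<eta> j k\<bar> \<le> (5 * real d) ^ d * P" for k
    proof -
      have "real_of_int \<bar>\<eta> j k\<bar> \<le> real_of_int (int ((2 * r + 3) ^ r * (\<Prod>i<r. W i)))"
        using eta_small j by (simp only: of_int_le_iff)
      then show ?thesis using bd by simp
    qed
    \<comment> \<open>Nonnegativity of the bound is read off from \<open>eb\<close> at index
      0.\<close>
    then show ?thesis
      by (intro supnorm_int_le) (use order_trans[OF _ eb[of 0]] in auto)
  qed
  moreover have "idot d (\<eta> j) x = 0" if j: "j < d - r" and x: "x \<in> X" for j x
  proof -
    have "x \<in> fv.span ((\<lambda>i k. real_of_int (w i k)) ` {..<r})" using x X_span by blast
    then show ?thesis
    proof (induction rule: fv.span_induct_alt)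
      case base
      show ?case unfolding idot_eq_ip by (rule ip_zero_right)
    next
      case (step c u v)
      then obtain i where i: "i < r" "u = (\<lambda>k. real_of_int (w i k))" by auto
      have "idot d (\<eta> j) u = real_of_int (\<Sum>k<d. w i k * \<eta> j k)"
        by (simp add: i idot_def mult.commute)
      then have "idot d (\<eta> j) u = 0" using eta_orth i j by simp
      then show ?case using step by (simp only: idot_eq_ip ip_add_right ip_scale_right)
    qed
  qed
  moreover have "\<bar>idot d (w i) a\<bar> \<le> P * (5 * real d * \<kappa> * L * (2 * real d + 5) ^ d)" if i: "i < r" for i
  proof -
    let ?s = "supnorm_int d (w i)" and ?R = "5 * real d * \<kappa> * L * (2 * real d + 5) ^ d"
    have s: "?s > 0" using sup1[OF i] by linarith
    define v where "v = fscale (1 / ?s) (\<lambda>k. real_of_int (w i k))"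
    have "v \<in> fv.span X" unfolding v_def using w_span[OF i] by (rule fv.span_scale)
    moreover have "\<bar>v k\<bar> \<le> 1" if "k < d" for k
      using abs_le_supnorm_int[OF that, of "w i"] s by (simp add: v_def fscale_def)
    ultimately have "\<bar>ip d a v\<bar> * real (card X) \<le> 5 * real d * \<kappa> * real N * (2 * real d + 5) ^ d"
      using functional_bound[OF _ \<kappa>] a by blast
    also have "\<dots> \<le> 5 * real d * \<kappa> * (L * real (card X)) * (2 * real d + 5) ^ d"
      using L \<kappa> by (intro mult_right_mono mult_left_mono) auto
    also have "\<dots> = ?R * real (card X)" by simp
    finally have av: "\<bar>ip d a v\<bar> \<le> ?R" using card' by (simp only: mult_le_cancel_right_pos)
    have "idot d (w i) a = ?s * ip d a v"
      using s by (simp add: idot_eq_ip v_def ip_commute[of d _ a])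
    then have "\<bar>idot d (w i) a\<bar> = ?s * \<bar>ip d a v\<bar>" using s by (simp add: abs_mult)
    also have "\<dots> \<le> P * ?R"
      using supP[OF i] av s by (intro mult_mono) auto
    finally show ?thesis .
  qed
  ultimately show ?thesis
    using r indep prP eta_orth by (intro exI[of _ r] exI[of _ w] exI[of _ \<eta>] conjI) auto
qed

end

text \<open>The size of n makes it prime to N, so by Bezout t is an integer combination of n t and N
  t.\<close>

lemma int_if_coprime_multiples_int:
  fixes t :: real
  assumes "prime N" "real N * t \<in> \<int>" "real_of_int n * t \<in> \<int>" "n \<noteq> 0" "\<bar>n\<bar> < int N"
  shows "t \<in> \<int>"
proof -
  have "\<not> int N dvd n" using assms(4,5) dvd_imp_le_int[of n "int N"] by auto
  then have "gcd n (int N) = 1"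
    using prime_imp_coprime[of "int N" n] assms(1) by (simp add: coprime_iff_gcd_eq_1 gcd.commute)
  then obtain u v where "u * n + v * int N = 1" using bezout_int[of n "int N"] by metis
  then have "real_of_int (u * n + v * int N) = 1" by simp
  then have "t = of_int u * (of_int n * t) + of_int v * (real N * t)"
    by (simp add: algebra_simps flip: distrib_left)
  then show ?thesis using assms(2,3) by (metis Ints_add Ints_mult Ints_of_int)
qed

lemma cfrac_abs_le: "\<bar>cfrac r\<bar> \<le> 1 / 2"
  unfolding cfrac_def by linarith

lemma card_le_fibre:
  assumes "finite A" "finite B" "f ` A \<subseteq> B" "A \<noteq> {}"
  obtains t where "t \<in> B" "card A \<le> card B * card {h \<in> A. f h = t}"
proof -
  have "B \<noteq> {}" using assms by auto
  have "card A = card (\<Union>t\<in>B. {h \<in> A. f h = t})" using assms(3) by (intro arg_cong[of _ _ card]) auto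
  also have "\<dots> \<le> (\<Sum>t\<in>B. card {h \<in> A. f h = t})" by (rule card_UN_le[OF assms(2)])
  finally have le: "card A \<le> (\<Sum>t\<in>B. card {h \<in> A. f h = t})" .
  define m where "m = Max ((\<lambda>t. card {h \<in> A. f h = t}) ` B)"
  have "m \<in> (\<lambda>t. card {h \<in> A. f h = t}) ` B"
    unfolding m_def using assms(2) \<open>B \<noteq> {}\<close> by (intro Max_in) auto
  then obtain t where t: "t \<in> B" "m = card {h \<in> A. f h = t}" by auto
  have "(\<Sum>t\<in>B. card {h \<in> A. f h = t}) \<le> (\<Sum>t\<in>B. m)"
    unfolding m_def using assms(2) by (intro sum_mono Max_ge) auto
  then show ?thesis using that t le by auto
qed

section \<open>Structure of the frequencies\<close>

text \<open>All bounds are polynomial in \<open>Q = d ^ d * M / \<delta>\<close>, since \<open>2 ^ d \<le> Q\<close>, \<open>d ^ d \<le> Q\<close> and \<open>10 \<le> Q\<close>.\<close>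

lemma parameter_bounds:
  fixes \<delta> M :: real
  assumes d: "d > 0" and \<delta>: "0 < \<delta>" "\<delta> < 1 / 10" and M: "M \<ge> 1"
  defines "Q \<equiv> real d ^ d * M / \<delta>" and "L \<equiv> (real d * M + 2) / \<delta>"
  shows "10 \<le> Q" "L \<le> Q ^ 2" "L * (30 * real d ^ 6) ^ d \<le> Q ^ 13"
    "(5 * real d) ^ d * (L * (30 * real d ^ 6) ^ d) \<le> Q ^ 17"
    "5 * real d * 2 * L * (2 * real d + 5) ^ d \<le> Q ^ 8"
proof -
  have d1: "real d \<ge> 1" using d by simp
  have dd1: "real d ^ d \<ge> 1" using d1 by simp
  have M\<delta>: "10 \<le> M / \<delta>" using M \<delta> by (simp add: field_simps)
  have "1 * (M / \<delta>) \<le> real d ^ d * (M / \<delta>)" using dd1 M\<delta> by (intro mult_right_mono) auto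
  then show Q10: "10 \<le> Q" using M\<delta> by (simp add: Q_def)
  have ddQ: "real d ^ d \<le> Q"
  proof -
    have "real d ^ d * 1 \<le> real d ^ d * (M / \<delta>)" using M\<delta> by (intro mult_left_mono) auto
    then show ?thesis by (simp add: Q_def)
  qed
  \<comment> \<open>For d = 1 the power d^d is only 1, and 10 \<le> Q is used instead.\<close>
  have twoQ: "2 ^ d \<le> Q"
  proof (cases "d = 1")
    case True
    then show ?thesis using Q10 by simp
  next
    case False
    then have "(2 :: real) ^ d \<le> real d ^ d" using d by (intro power_mono) auto
    then show ?thesis using ddQ by simp
  qed
  have d_le: "real d \<le> real d ^ d" using power_increasing[of 1 d "real d"] d d1 by simp
  have pw: "(2 ^ n) ^ d \<le> Q ^ n" for n :: nat
    using power_mono[OF twoQ, of n] by (simp add: mult.commute flip: power_mult)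
  have L0: "L \<ge> 0" using M \<delta> by (simp add: L_def)
  have "real d * M / \<delta> \<le> Q"
    unfolding Q_def using d_le M \<delta> by (intro divide_right_mono mult_right_mono) auto
  moreover have "L \<le> 3 * (real d * M / \<delta>)"
  proof -
    have "2 \<le> 2 * (real d * M)" using mult_mono[of 1 "real d" 1 M] d1 M by linarith
    then have "real d * M + 2 \<le> 3 * (real d * M)" by linarith
    then have "L \<le> 3 * (real d * M) / \<delta>" unfolding L_def using \<delta> by (intro divide_right_mono) auto
    then show ?thesis by simp
  qed
  ultimately have "L \<le> 3 * Q" by linarith
  also have "\<dots> \<le> Q * Q" using Q10 by (intro mult_right_mono) auto
  finally show LQ: "L \<le> Q ^ 2" by (simp add: power2_eq_square)
  \<comment> \<open>With 30 \<le> 2^5 the left side is at most (2^d)^5 (d^d)^6, hence at most Q^(5 +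
    6).\<close>
  have A: "(30 * real d ^ 6) ^ d \<le> Q ^ 11"
  proof -
    have "(30 * real d ^ 6) ^ d \<le> ((2 ^ 5) * real d ^ 6) ^ d"
      by (intro power_mono mult_right_mono) auto
    also have "\<dots> = (2 ^ 5) ^ d * (real d ^ d) ^ 6"
      by (simp only: power_mult_distrib mult.commute flip: power_mult)
    also have "\<dots> \<le> Q ^ 5 * Q ^ 6"
      using pw[of 5] power_mono[OF ddQ, of 6] Q10 by (intro mult_mono) auto
    finally show ?thesis by (simp flip: power_add)
  qed
  have "L * (30 * real d ^ 6) ^ d \<le> Q ^ 2 * Q ^ 11" using A LQ Q10 by (intro mult_mono) auto
  then show B: "L * (30 * real d ^ 6) ^ d \<le> Q ^ 13" by (simp flip: power_add)
  \<comment> \<open>Both 5 d and 2 d + 5 are at most 8 d, so this one estimate serves for both of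
    their d-th powers.\<close>
  have lin: "((2 ^ 3) * real d) ^ d \<le> Q ^ 4"
  proof -
    have "((2 ^ 3) * real d) ^ d = (2 ^ 3) ^ d * real d ^ d" by (rule power_mult_distrib)
    also have "\<dots> \<le> Q ^ 3 * Q" using pw[of 3] ddQ Q10 by (intro mult_mono) auto
    finally show ?thesis by (simp add: eval_nat_numeral mult_ac)
  qed
  have "(5 * real d) ^ d \<le> ((2 ^ 3) * real d) ^ d" by (intro power_mono mult_right_mono) auto
  with lin have "(5 * real d) ^ d \<le> Q ^ 4" by linarith
  then have "(5 * real d) ^ d * (L * (30 * real d ^ 6) ^ d) \<le> Q ^ 4 * Q ^ 13"
    using B L0 Q10 by (intro mult_mono) auto
  then show "(5 * real d) ^ d * (L * (30 * real d ^ 6) ^ d) \<le> Q ^ 17" by (simp flip: power_add)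
  have "(2 * real d + 5) ^ d \<le> ((2 ^ 3) * real d) ^ d" using d1 by (intro power_mono) auto
  with lin have C: "(2 * real d + 5) ^ d \<le> Q ^ 4" by linarith
  have "(10 * real d) * L \<le> (Q * Q) * Q ^ 2"
    using Q10 LQ L0 order_trans[OF d_le ddQ] by (intro mult_mono) auto
  then have "(10 * real d * L) * (2 * real d + 5) ^ d \<le> ((Q * Q) * Q ^ 2) * Q ^ 4"
    using Q10 by (intro mult_mono[OF _ C]) auto
  also have "\<dots> = Q ^ 8" by (simp add: eval_nat_numeral mult_ac)
  finally show "5 * real d * 2 * L * (2 * real d + 5) ^ d \<le> Q ^ 8" by (simp add: mult_ac)
qed

text \<open>The case in which some coordinate of \<alpha> is not an integer: as N is prime,
  different members of the pigeonhole class then give different points, so \<open>X\<close> is as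
  large as the class.\<close>

lemma bracket_structure:
  fixes d N :: nat and \<delta> K M \<beta> :: real and \<alpha> a :: "nat \<Rightarrow> real"
  defines "Q \<equiv> real d ^ d * M / \<delta>"
  assumes \<delta>: "0 < \<delta>" "\<delta> < 1 / 10" and K: "0 < K" and M: "1 \<le> M" and N: "prime N"
    and N\<alpha>: "\<And>i. i < d \<Longrightarrow> real N * \<alpha> i \<in> \<int>" and a: "\<And>i. i < d \<Longrightarrow> \<bar>a i\<bar> \<le> M"
    and many: "real (card {h \<in> {1..N}. rz_norm (\<beta> + (\<Sum>i<d. a i * cfrac (\<alpha> i * real h))) < K / real N})
      \<ge> \<delta> * real N"
    and nonint: "\<exists>i<d. \<alpha> i \<notin> \<int>"
  shows "real N \<le> Q ^ 100 \<or>
     (\<exists>r\<le>d. \<exists>w \<eta> :: nat \<Rightarrow> nat \<Rightarrow> int.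
        lin_indep_int d r w \<and> (\<Prod>i<r. supnorm_int d (w i)) \<le> Q ^ 100 \<and>
        lin_indep_int d (d - r) \<eta> \<and> (\<forall>j<d - r. supnorm_int d (\<eta> j) \<le> Q ^ 100) \<and>
        (\<forall>i<r. \<forall>j<d - r. (\<Sum>k<d. w i k * \<eta> j k) = 0) \<and>
        (\<forall>j<d - r. idot d (\<eta> j) \<alpha> \<in> \<int>) \<and>
        (\<forall>i<r. \<bar>idot d (w i) a\<bar> \<le> Q ^ 100 * K / real N))"
proof -
  obtain i0 where i0: "i0 < d" "\<alpha> i0 \<notin> \<int>" using nonint by blast
  have d: "d > 0" using i0 by simp
  have N0: "N > 0" using N by (simp add: prime_gt_0_nat)
  define L where "L = (real d * M + 2) / \<delta>"
  note bounds = parameter_bounds[OF d \<delta> M, folded Q_def L_def]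
  \<comment> \<open>100 is a common exponent exceeding those that occur: 2, 13, 17 and 21.\<close>
  have Qmono: "Q ^ m \<le> Q ^ 100" if "m \<le> 100" for m
    using bounds(1) that by (intro power_increasing) auto
  define x where "x h k = (if k < d then cfrac (\<alpha> k * real h) else 0)" for h k
  define \<theta> where "\<theta> h = \<beta> + (\<Sum>i<d. a i * cfrac (\<alpha> i * real h))" for h :: nat
  \<comment> \<open>The integer that \<open>cfrac\<close> subtracts from \<open>\<theta> h\<close>.
    On a class where it is constant, all \<open>\<theta> h\<close> lie within K / N of the same
    integer.\<close>
  define m where "m h = \<lceil>\<theta> h - 1 / 2\<rceil>" for h
  define S where "S = {h \<in> {1..N}. rz_norm (\<theta> h) < K / real N}"
  have S: "\<delta> * real N \<le> real (card S)" using many by (simp add: S_def \<theta>_def)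
  have finS: "finite S" by (simp add: S_def)
  have "\<delta> * real N > 0" using \<delta>(1) N0 by simp
  then have "S \<noteq> {}" using S by auto
  \<comment> \<open>\<open>\<theta> h\<close> stays within d M / 2 of \<beta>, so \<open>m\<close>
    takes at most d M + 2 values.\<close>
  define lo hi where "lo = \<lceil>\<beta> - real d * M / 2 - 1 / 2\<rceil>" and "hi = \<lceil>\<beta> + real d * M / 2 - 1 / 2\<rceil>"
  have \<theta>_bound: "\<bar>\<theta> h - \<beta>\<bar> \<le> real d * M / 2" for h
  proof -
    have "\<bar>\<Sum>i<d. a i * cfrac (\<alpha> i * real h)\<bar> \<le> (\<Sum>i<d. \<bar>a i * cfrac (\<alpha> i * real h)\<bar>)"
      by (rule sum_abs)
    also have "\<dots> \<le> (\<Sum>i<d. M * (1 / 2))"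
      unfolding abs_mult using a M cfrac_abs_le by (intro sum_mono mult_mono) auto
    finally show ?thesis by (simp add: \<theta>_def)
  qed
  have "m ` S \<subseteq> {lo..hi}"
  proof (intro image_subsetI)
    fix h
    have "\<beta> - real d * M / 2 - 1 / 2 \<le> \<theta> h - 1 / 2" "\<theta> h - 1 / 2 \<le> \<beta> + real d * M / 2 - 1 / 2"
      using \<theta>_bound[of h] by linarith+
    then show "m h \<in> {lo..hi}" unfolding m_def lo_def hi_def by (auto intro: ceiling_mono)
  qed
  then obtain t where t: "card S \<le> card {lo..hi} * card {h \<in> S. m h = t}"
    using card_le_fibre[OF finS finite_atLeastAtMost_int _ \<open>S \<noteq> {}\<close>] by metis
  define F where "F = {h \<in> S. m h = t}"
  have FN: "h \<in> {1..N}" if "h \<in> F" for h using that by (simp add: F_def S_def)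
  have finF: "finite F" using finS by (simp add: F_def)
  have dM: "real d * M \<ge> 0" using M by simp
  have "real (card {lo..hi}) \<le> real d * M + 2"
    unfolding card_atLeastAtMost_int lo_def hi_def using dM by linarith
  then have "real (card {lo..hi}) * real (card F) \<le> (real d * M + 2) * real (card F)"
    by (intro mult_right_mono) auto
  moreover have "real (card S) \<le> real (card {lo..hi}) * real (card F)"
    using t unfolding F_def by (simp only: of_nat_le_iff flip: of_nat_mult)
  ultimately have "\<delta> * real N \<le> (real d * M + 2) * real (card F)" using S by linarith
  then have LF: "real N \<le> L * real (card F)" using \<delta>(1) by (simp add: L_def field_simps)
  have "card F > 0"
  proof (rule ccontr)
    assume "\<not> ?thesis"
    then show False using LF N0 by simp
  qed
  then obtain h0 where h0: "h0 \<in> F" by (metis card_gt_0_iff ex_in_conv)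
  have diff: "h \<noteq> h' \<Longrightarrow> int h - int h' \<noteq> 0" "\<bar>int h - int h'\<bar> < int N" if "h \<in> F" "h' \<in> F" for h h'
    using FN[OF that(1)] FN[OF that(2)] by auto
  have x_diff: "x h k - x h' k - of_int (int h - int h') * \<alpha> k \<in> \<int>" if "k < d" for h h' k
  proof -
    have "x h k - x h' k - of_int (int h - int h') * \<alpha> k
        = of_int (\<lceil>\<alpha> k * real h' - 1 / 2\<rceil> - \<lceil>\<alpha> k * real h - 1 / 2\<rceil>)"
      using that by (simp add: x_def cfrac_def algebra_simps)
    then show ?thesis by (metis Ints_of_int)
  qed
  have inj: "inj_on (\<lambda>h. x h - x h0) F"
  proof (rule inj_onI, rule ccontr)
    fix h h' assume hh: "h \<in> F" "h' \<in> F" "x h - x h0 = x h' - x h0" "h \<noteq> h'"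
    \<comment> \<open>A collision would make (h - h') times \<alpha> at \<open>i0\<close> an
      integer, and hence that coordinate itself, as 0 < \<bar>h - h'\<bar> < N.\<close>
    have "x h i0 - x h' i0 = 0" using fun_cong[OF hh(3), of i0] by simp
    then have "of_int (int h - int h') * \<alpha> i0 \<in> \<int>"
      using x_diff[OF i0(1), of h h'] by (metis Ints_minus diff_0 minus_minus)
    then show False
      using int_if_coprime_multiples_int[OF N N\<alpha>[OF i0(1)]] diff[OF hh(1,2)] hh(4) i0(2) by blast
  qed
  define X where "X = (\<lambda>h. x h - x h0) ` F"
  have cardX: "card X = card F" unfolding X_def by (rule card_image[OF inj])
  show ?thesis
  proof (cases "F = {h0}")
    \<comment> \<open>A single member provides no nonzero difference of indices, but then N \<le>
      L.\<close>
    case True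
    then have "real N \<le> Q ^ 100" using LF bounds(2) Qmono[of 2] by simp
    then show ?thesis ..
  next
    case False
    then obtain h1 where h1: "h1 \<in> F" "h1 \<noteq> h0" using h0 by blast
    interpret dense_lattice_points d N \<alpha> X
    proof
      show "d > 0" "N > 0" "\<And>k. k < d \<Longrightarrow> real N * \<alpha> k \<in> \<int>" using d N0 N\<alpha> by auto
      show "X \<subseteq> bohr_lattice d \<alpha>"
      proof
        fix y assume "y \<in> X"
        then obtain h where h: "y = x h - x h0" by (auto simp: X_def)
        have "y \<in> supp_below d" by (simp add: h supp_below_def x_def)
        moreover have "\<forall>k<d. y k - of_int (int h - int h0) * \<alpha> k \<in> \<int>"
          using x_diff by (simp add: h)
        ultimately show "y \<in> bohr_lattice d \<alpha>" unfolding bohr_lattice_def by blast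
      qed
      fix y k assume "y \<in> X" and k: "k < d"
      then obtain h where h: "y = x h - x h0" by (auto simp: X_def)
      show "\<bar>y k\<bar> \<le> 1"
        using cfrac_abs_le[of "\<alpha> k * real h"] cfrac_abs_le[of "\<alpha> k * real h0"] k
        by (simp add: h x_def)
    qed
    have ax: "\<forall>y\<in>X. \<bar>ip d a y\<bar> \<le> 2 * K / real N"
    proof
      fix y assume y: "y \<in> X"
      obtain h where h: "h \<in> F" "y = x h - x h0" using y by (auto simp: X_def)
      \<comment> \<open>The shift \<beta> cancels in differences; two members of the class are each
        within K / N of t, which gives 2 K / N.\<close>
      have ipx: "ip d a (x h) = \<theta> h - \<beta>" for h by (simp add: ip_def x_def \<theta>_def)
      have "\<bar>\<theta> h - of_int t\<bar> < K / real N" "\<bar>\<theta> h0 - of_int t\<bar> < K / real N"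
        using h(1) h0 by (auto simp: F_def S_def m_def rz_norm_def cfrac_def)
      then show "\<bar>ip d a y\<bar> \<le> 2 * K / real N" by (simp add: h(2) ipx)
    qed
    have \<kappa>: "2 * K / real N > 0" using K N0 by simp
    have "card X > 0" "real N \<le> L * real (card X)" using cardX \<open>card F > 0\<close> LF by auto
    from short_orthogonal_systems[OF ax \<kappa> this]
    obtain r w \<eta> where r: "r \<le> d" and
      props: "lin_indep_int d r w" "(\<Prod>i<r. supnorm_int d (w i)) \<le> L * (30 * real d ^ 6) ^ d"
      "lin_indep_int d (d - r) \<eta>"
      "\<forall>j<d - r. supnorm_int d (\<eta> j) \<le> (5 * real d) ^ d * (L * (30 * real d ^ 6) ^ d)"
      "\<forall>i<r. \<forall>j<d - r. (\<Sum>k<d. w i k * \<eta> j k) = 0"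
      "\<forall>j<d - r. \<forall>x\<in>X. idot d (\<eta> j) x = 0"
      "\<forall>i<r. \<bar>idot d (w i) a\<bar> \<le> L * (30 * real d ^ 6) ^ d *
         (5 * real d * (2 * K / real N) * L * (2 * real d + 5) ^ d)"
      by (elim exE conjE) (rule that)
    have "idot d (\<eta> j) \<alpha> \<in> \<int>" if j: "j < d - r" for j
    proof (rule int_if_coprime_multiples_int[OF N])
      show "real N * idot d (\<eta> j) \<alpha> \<in> \<int>"
      proof -
        have "real N * idot d (\<eta> j) \<alpha> = (\<Sum>k<d. of_int (\<eta> j k) * (real N * \<alpha> k))"
          by (simp add: idot_def sum_distrib_left mult_ac)
        also have "\<dots> \<in> \<int>" using N\<alpha> by (intro Ints_sum Ints_mult[OF Ints_of_int]) auto
        finally show ?thesis .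
      qed
      \<comment> \<open>Modulo Z^d this point is (h1 - h0) \<alpha>. Since \<open>\<eta> j\<close>
        annihilates it, (h1 - h0) times \<open>idot d (\<eta> j) \<alpha>\<close> is an
        integer.\<close>
      define y where "y = x h1 - x h0"
      have "y \<in> X" using h1(1) by (auto simp: X_def y_def)
      then have y0: "idot d (\<eta> j) y = 0" using props(6) j by blast
      have "of_int (int h1 - int h0) * idot d (\<eta> j) \<alpha>
          = idot d (\<eta> j) y - (\<Sum>k<d. of_int (\<eta> j k) * (y k - of_int (int h1 - int h0) * \<alpha> k))"
        by (simp add: idot_def sum_distrib_left algebra_simps sum_subtractf sum.distrib)
      also have "\<dots> \<in> \<int>"
      proof -
        have "y k - of_int (int h1 - int h0) * \<alpha> k \<in> \<int>" if "k < d" for k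
          using x_diff[OF that] by (simp add: y_def)
        then have "(\<Sum>k<d. of_int (\<eta> j k) * (y k - of_int (int h1 - int h0) * \<alpha> k)) \<in> \<int>"
          by (intro Ints_sum Ints_mult[OF Ints_of_int]) blast
        then show ?thesis by (simp add: y0)
      qed
      finally show "of_int (int h1 - int h0) * idot d (\<eta> j) \<alpha> \<in> \<int>" .
      show "int h1 - int h0 \<noteq> 0" "\<bar>int h1 - int h0\<bar> < int N"
        using diff[OF h1(1) h0] h1(2) by auto
    qed
    moreover have "\<bar>idot d (w i) a\<bar> \<le> Q ^ 100 * K / real N" if i: "i < r" for i
    proof -
      have "\<bar>idot d (w i) a\<bar> \<le> L * (30 * real d ^ 6) ^ d *
         (5 * real d * (2 * K / real N) * L * (2 * real d + 5) ^ d)" using props(7) i by blast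
      also have "\<dots> = (L * (30 * real d ^ 6) ^ d) * (5 * real d * 2 * L * (2 * real d + 5) ^ d) * (K / real N)"
        by simp
      also have "\<dots> \<le> Q ^ 13 * Q ^ 8 * (K / real N)"
      proof (intro mult_right_mono mult_mono bounds(3,5))
        show "0 \<le> 5 * real d * 2 * L * (2 * real d + 5) ^ d"
          using dM \<delta>(1) by (simp add: L_def)
      qed (use bounds(1) K in auto)
      also have "\<dots> = Q ^ 21 * (K / real N)" by (simp flip: power_add)
      also have "\<dots> \<le> Q ^ 100 * (K / real N)"
        using Qmono[of 21] K by (intro mult_right_mono) auto
      finally show ?thesis by simp
    qed
    moreover have "(\<Prod>i<r. supnorm_int d (w i)) \<le> Q ^ 100"
      using props(2) bounds(3) Qmono[of 13] by linarith
    moreover have "\<forall>j<d - r. supnorm_int d (\<eta> j) \<le> Q ^ 100"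
      using props(4) bounds(4) Qmono[of 17] by fastforce
    ultimately show ?thesis using r props(1,3,5) by blast
  qed
qed

section \<open>Real powers and the case of integral \<alpha>\<close>

theorem lemmal:
  shows "\<exists>C::real>0. \<forall>(d::nat) (\<delta>::real) (K::real) (M::real) (N::nat)
           (\<alpha>::nat \<Rightarrow> real) (a::nat \<Rightarrow> real) (\<beta>::real).
    0 < \<delta> \<and> \<delta> < 1/10 \<and> 0 < K \<and> 1 \<le> M \<and> prime N \<and> odd N \<and>
    (\<forall>i<d. real N * \<alpha> i \<in> \<int>) \<and> (\<forall>i<d. \<bar>a i\<bar> \<le> M) \<and>
    real (card {h \<in> {1..N}. rz_norm (\<beta> + (\<Sum>i<d. a i * cfrac (\<alpha> i * real h))) < K / real N})
      \<ge> \<delta> * real N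
    \<longrightarrow>
    ((real N \<le> C * (\<delta> / (real d ^ d * M)) powr (-C) \<or> K / real N > 1/10) \<or>
     (\<exists>r\<le>d. \<exists>w \<eta> :: nat \<Rightarrow> nat \<Rightarrow> int.
        lin_indep_int d r w \<and>
        (\<Prod>i<r. supnorm_int d (w i)) \<le> (\<delta> / (real d ^ d * M)) powr (-C) \<and>
        lin_indep_int d (d - r) \<eta> \<and>
        (\<forall>j<d - r. supnorm_int d (\<eta> j) \<le> (\<delta> / (real d ^ d * M)) powr (-C)) \<and>
        (\<forall>i<r. \<forall>j<d - r. (\<Sum>k<d. w i k * \<eta> j k) = 0) \<and>
        (\<forall>j<d - r. rz_norm (idot d (\<eta> j) \<alpha>) = 0) \<and>
        (\<forall>i<r. \<bar>idot d (w i) a\<bar> \<le> (\<delta> / M) powr (-C) * (real d ^ d) powr C * K / real N)))"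
proof (intro exI[of _ 100] conjI allI impI, goal_cases)
  case 1
  show ?case by simp
next
  case (2 d \<delta> K M N \<alpha> a \<beta>)
  then have \<delta>: "0 < \<delta>" "\<delta> < 1 / 10" and K: "0 < K" and M: "1 \<le> M" and N: "prime N"
    and N\<alpha>: "\<And>i. i < d \<Longrightarrow> real N * \<alpha> i \<in> \<int>" and a: "\<And>i. i < d \<Longrightarrow> \<bar>a i\<bar> \<le> M"
    and many: "real (card {h \<in> {1..N}. rz_norm (\<beta> + (\<Sum>i<d. a i * cfrac (\<alpha> i * real h))) < K / real N})
      \<ge> \<delta> * real N"
    by blast+
  define Q where "Q = real d ^ d * M / \<delta>"
  \<comment> \<open>For \<open>d = 0\<close> the value is 0^0 = 1.\<close>
  have dd: "real d ^ d > 0" by (cases "d = 0") auto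
  have powr_neg: "u powr (- 100) = (1 / u) ^ 100" if "u > 0" for u :: real
    using that by (simp add: powr_minus power_divide powr_realpow' inverse_eq_divide)
  have Q1: "(\<delta> / (real d ^ d * M)) powr (- 100) = Q ^ 100"
    using \<delta> M dd by (subst powr_neg) (auto simp: Q_def)
  have Q2: "(\<delta> / M) powr (- 100) * (real d ^ d) powr 100 = Q ^ 100"
  proof -
    have "(real d ^ d) powr 100 = (real d ^ d) ^ 100"
      using dd powr_realpow[of "real d ^ d" 100] by simp
    then show ?thesis
      using \<delta> M by (subst powr_neg) (auto simp: Q_def power_mult_distrib power_divide)
  qed
  have rz: "rz_norm u = 0" if "u \<in> \<int>" for u
  proof -
    from that obtain n where "u = of_int n" by (rule Ints_cases)
    moreover have "\<lceil>real_of_int n - 1 / 2\<rceil> = n" by linarith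
    ultimately show ?thesis by (simp add: rz_norm_def cfrac_def)
  qed
  have Q_ge_1: "Q ^ 100 \<ge> 1"
  proof (rule one_le_power)
    have "real d ^ d \<ge> 1" by (cases "d = 0") auto
    then have "1 * 1 \<le> real d ^ d * M" using M by (intro mult_mono) auto
    then show "1 \<le> Q" using \<delta> by (simp add: Q_def field_simps)
  qed
  show ?case
    unfolding Q1 Q2
  proof (cases "\<exists>i<d. \<alpha> i \<notin> \<int>")
    case True
    from bracket_structure[OF \<delta> K M N N\<alpha> a many True, folded Q_def]
    show "(real N \<le> 100 * Q ^ 100 \<or> K / real N > 1/10) \<or>
     (\<exists>r\<le>d. \<exists>w \<eta> :: nat \<Rightarrow> nat \<Rightarrow> int.
        lin_indep_int d r w \<and> (\<Prod>i<r. supnorm_int d (w i)) \<le> Q ^ 100 \<and>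
        lin_indep_int d (d - r) \<eta> \<and> (\<forall>j<d - r. supnorm_int d (\<eta> j) \<le> Q ^ 100) \<and>
        (\<forall>i<r. \<forall>j<d - r. (\<Sum>k<d. w i k * \<eta> j k) = 0) \<and>
        (\<forall>j<d - r. rz_norm (idot d (\<eta> j) \<alpha>) = 0) \<and>
        (\<forall>i<r. \<bar>idot d (w i) a\<bar> \<le> Q ^ 100 * K / real N))"
    proof
      assume "real N \<le> Q ^ 100"
      then show ?thesis using Q_ge_1 by linarith
    next
      assume "\<exists>r\<le>d. \<exists>w \<eta> :: nat \<Rightarrow> nat \<Rightarrow> int.
        lin_indep_int d r w \<and> (\<Prod>i<r. supnorm_int d (w i)) \<le> Q ^ 100 \<and>
        lin_indep_int d (d - r) \<eta> \<and> (\<forall>j<d - r. supnorm_int d (\<eta> j) \<le> Q ^ 100) \<and>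
        (\<forall>i<r. \<forall>j<d - r. (\<Sum>k<d. w i k * \<eta> j k) = 0) \<and>
        (\<forall>j<d - r. idot d (\<eta> j) \<alpha> \<in> \<int>) \<and>
        (\<forall>i<r. \<bar>idot d (w i) a\<bar> \<le> Q ^ 100 * K / real N)"
      then show ?thesis using rz by (intro disjI2) (elim ex_forward conj_forward; blast)
    qed
  next
    case False
    \<comment> \<open>If \<alpha> is integral, in particular if d = 0, take r = 0 and the standard
      basis; as the family w is empty, \<open>\<eta>\<close> also serves as its witness.\<close>
    define \<eta> :: "nat \<Rightarrow> nat \<Rightarrow> int" where "\<eta> j k = (if k = j then 1 else 0)" for j k
    have "lin_indep_int d d \<eta>"
      unfolding lin_indep_int_def
    proof (intro allI impI)
      fix c :: "nat \<Rightarrow> real" and i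
      assume c: "\<forall>k<d. (\<Sum>j<d. c j * real_of_int (\<eta> j k)) = 0" and i: "i < d"
      have "(\<Sum>j<d. c j * real_of_int (\<eta> j i)) = (\<Sum>j<d. if j = i then c j else 0)"
        by (intro sum.cong) (auto simp: \<eta>_def)
      then show "c i = 0" using c i by simp
    qed
    moreover have "supnorm_int d (\<eta> j) \<le> Q ^ 100" for j
      using Q_ge_1 by (intro supnorm_int_le) (auto simp: \<eta>_def)
    moreover have "rz_norm (idot d (\<eta> j) \<alpha>) = 0" if "j < d" for j
    proof (rule rz)
      show "idot d (\<eta> j) \<alpha> \<in> \<int>"
        unfolding idot_def using False by (intro Ints_sum Ints_mult) auto
    qed
    ultimately have "lin_indep_int d 0 \<eta> \<and> (\<Prod>i<(0::nat). supnorm_int d (\<eta> i)) \<le> Q ^ 100 \<and>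
        lin_indep_int d (d - 0) \<eta> \<and> (\<forall>j<d - 0. supnorm_int d (\<eta> j) \<le> Q ^ 100) \<and>
        (\<forall>i<0. \<forall>j<d - 0. (\<Sum>k<d. \<eta> i k * \<eta> j k) = 0) \<and>
        (\<forall>j<d - 0. rz_norm (idot d (\<eta> j) \<alpha>) = 0) \<and>
        (\<forall>i<0. \<bar>idot d (\<eta> i) a\<bar> \<le> Q ^ 100 * K / real N)"
      using Q_ge_1 by (simp add: lin_indep_int_def[of d 0])
    then show "(real N \<le> 100 * Q ^ 100 \<or> K / real N > 1/10) \<or>
     (\<exists>r\<le>d. \<exists>w \<eta> :: nat \<Rightarrow> nat \<Rightarrow> int.
        lin_indep_int d r w \<and> (\<Prod>i<r. supnorm_int d (w i)) \<le> Q ^ 100 \<and>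
        lin_indep_int d (d - r) \<eta> \<and> (\<forall>j<d - r. supnorm_int d (\<eta> j) \<le> Q ^ 100) \<and>
        (\<forall>i<r. \<forall>j<d - r. (\<Sum>k<d. w i k * \<eta> j k) = 0) \<and>
        (\<forall>j<d - r. rz_norm (idot d (\<eta> j) \<alpha>) = 0) \<and>
        (\<forall>i<r. \<bar>idot d (w i) a\<bar> \<le> Q ^ 100 * K / real N))"
      by (intro disjI2) blast
  qed
qed

end
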